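(* Suppose that assumptions (a)-(e) of the context hold. Let the sequence $\{y^t,x^t,\mu^t\}$ be generated by the stochastic Bregman parallel direction method of multipliers (stochastic BPDMM) described in the context, let $V(t)$ be the Lyapunov function defined in the context, and let $\overline{x}^T=\frac{1}{T}\sum_{t=0}^{T-1}x^t$. If $\rho,\tau,\gamma,\omega$ satisfy $$\tau\le \frac{\rho(\omega\alpha\sigma-\gamma)}{2-\omega},\qquad 0<\gamma<\omega\alpha\sigma,$$ where $\sigma=\min\{1,n^{\frac{2}{p}-1}\}$ and $\alpha$, $p$ are as in assumption (c), then $$\mathbb{E}_{\mathcal{S}_{1:T}}\big[L(\overline{x}^T,\mu^\star)-L(x^\star,\mu^\star)\big]\le\frac{V(0)}{\omega T},$$ $$\mathbb{E}_{\mathcal{S}_{1:T}}\Big[\tfrac12\big\|((I_{|\mathcal{V}|}-P)\otimes I_n)\overline{x}^T\big\|_2^2\Big]\le\frac{V(0)}{\gamma\rho T}.$$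
   Context: **Graph and matrix.** $\mathcal{G}=(\mathcal{V},\mathcal{E})$ is an undirected connected graph with vertex set $\mathcal{V}=\{1,2,\dots,m\}$ and edge set $\mathcal{E}\subseteq\mathcal{V}\times\mathcal{V}$ such that $(i,j)\in\mathcal{E}$ if and only if $(j,i)\in\mathcal{E}$; $\mathcal{N}(i)$ is the set of neighbors of node $i$, with $j\in\mathcal{N}(i)$ if $(i,j)\in\mathcal{E}$. $P\in\mathbb{R}^{|\mathcal{V}|\times|\mathcal{V}|}$ is a matrix defined on $\mathcal{G}$ in the sense that $P_{ij}>0$ implies $j\in\mathcal{N}(i)$. Put $Q=I_{|\mathcal{V}|}-P$. Vectors $x\in\mathbb{R}^{|\mathcal{V}|n}$ are written in blocks $x=[x_1^\top,\dots,x_{|\mathcal{V}|}^\top]^\top$ with $x_i\in\mathbb{R}^n$, and similarly for $\mu$ and $y$. $\otimes$ is the Kronecker product and $\langle\cdot,\cdot\rangle$ the dot product. **Subgradients.** $\partial f(u)$ is the set of $g\in\mathbb{R}^n$ with $f(v)-f(u)\ge\langle g,v-u\rangle$ for all $v\in\mathbb{R}^n$. The indicator function $\delta_{\mathcal{X}}$ of a convex set $\mathcal{X}$ is $0$ on $\mathcal{X}$ and $+\infty$ elsewhere. **Mirror map and Bregman divergence.** For a convex open set $\mathcal{D}\subseteq\mathbb{R}^n$, $\phi:\mathcal{D}\to\mathbb{R}$ is a mirror map if it is differentiable and strictly convex, $\nabla\phi$ takes all possible values, and $\nabla\phi$ diverges on the boundary of the closure of $\mathcal{D}$, i.e. $\lim_{u\to\partial\overline{\mathcal{D}}}\|\nabla\phi(u)\|=\infty$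 (for an arbitrary norm on $\mathbb{R}^n$). The Bregman divergence is $B_\phi(u,v)=\phi(u)-\phi(v)-\langle\nabla\phi(v),u-v\rangle$. **Assumptions.** (a) $f_i:\mathbb{R}^n\to\mathbb{R}\cup\{+\infty\}$ is closed, proper and convex for all $i\in\mathcal{V}$. (b) $\mathcal{X}\subset\mathbb{R}^n$ is closed and convex. There exists a saddle point $(x^\star,\mu^\star)$ such that, for all $i\in\mathcal{V}$, $x_i^\star\in\mathcal{X}$, $\sum_{j\in\mathcal{V}}P_{ij}x_j^\star=x_i^\star$ and $-\mu_i^\star+\sum_{j\in\mathcal{V}}P_{ij}\mu_j^\star\in\partial(f_i+\delta_\mathcal{X})(x_i^\star)$. (c) $\phi:\mathcal{D}\to\mathbb{R}$ is a mirror map, where $\mathcal{D}$ is an open convex set such that $\mathcal{X}$ is included in its closure. In addition, $\phi$ is $\alpha$-strongly convex with respect to the $l_p$-norm, i.e. $B_\phi(u,v)\ge\frac{\alpha}{2}\|u-v\|_p^2$ for any $u,v\in\mathcal{X}$. (d) $P$ is symmetric, stochastic, irreducible and positive semi-definite. (e) At each iteration $t+1$, $|\mathcal{S}_{t+1}|/|\mathcal{V}|=\omega$ with $0<\omega<1$, where $\mathcal{S}_{t+1}$ is the randomly selected set of nodes in the algorithm below. **Stochastic BPDMM.** Parameters $\tau,\rho>0$; initial point $x^0\in(\mathcal{X}\cap\mathcal{D})^{|\mathcal{V}|}$, $\mu^0\in\mathbb{R}^{|\mathcal{V}|n}$. For $t=0,1,2,\dots$, randomly select a subset of nodes $\mathcal{S}_{t+1}\subset\mathcal{V}$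 and set - for all $i\in\mathcal{S}_{t+1}$: $y_i^t=\mathrm{argmin}_{y_i\in\mathcal{X}}\sum_{j\in\mathcal{N}(i)}P_{ij}B_\phi(y_i,x_j^t)$; - for all $i\in\mathcal{S}_{t+1}$: $x_i^{t+1}=\mathrm{argmin}_{x_i\in\mathcal{X}}\ f_i(x_i)+\langle x_i,\mu_i^t-\sum_{j\in\mathcal{N}(i)}P_{ij}\mu_j^t\rangle+\rho B_\phi(x_i,y_i^t)$; - for all $i\in\mathcal{V}\setminus\mathcal{S}_{t+1}$: $x_i^{t+1}=x_i^t$; - for all $i\in\mathcal{V}$: $\mu_i^{t+1}=\mu_i^t+\tau x_i^{t+1}-\tau\sum_{j\in\mathcal{N}(i)}P_{ij}x_j^{t+1}$. $\mathcal{S}_{1:T}$ denotes the history of selected node sets $\{\mathcal{S}_1,\dots,\mathcal{S}_T\}$, and $\mathbb{E}_{\mathcal{S}_{1:T}}$ the expectation over the realization of $\mathcal{S}_{1:T}$. **Definitions.** $$L(x,\mu)=\sum_{i\in\mathcal{V}}(f_i+\delta_\mathcal{X})(x_i)+\langle\mu,(Q\otimes I_n)x\rangle,$$ $$H(x^t,\mu^t)=L(x^t,\mu^t)-L(x^\star,\mu^\star)-\tau\|(Q\otimes I_n)x^t\|_2^2,$$ $$V(t)=H(x^t,\mu^t)+\frac{\omega}{2\tau}\|\mu^\star-\mu^{t-1}\|_2^2+\rho\sum_{i\in\mathcal{V}}B_\phi(x_i^\star,x_i^t),$$ with $\mu^{-1}:=\mu^0-\tau(Q\otimes I_n)x^0$.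 *)

theory Defs
  imports "HOL-Probability.Probability"
begin

text \<open>A vector of \<open>\<real>\<^bsup>|V|n\<^esup>\<close> is an element of \<open>real^('v \<times> 'n)\<close>; its block \<open>i\<close> is the
  vector of the entries with first index \<open>i\<close>.\<close>

definition block :: "real^('v::finite \<times> 'n::finite) \<Rightarrow> 'v \<Rightarrow> real^'n" where
  "block x i = (\<chi> k. x $ (i, k))"

definition kronecker ::
    "real^'b^'a \<Rightarrow> real^'d^'c \<Rightarrow> real^('b::finite \<times> 'd::finite)^('a::finite \<times> 'c::finite)" where
  "kronecker A B = (\<chi> r s. A $ fst r $ fst s * B $ snd r $ snd s)"

text \<open>The vector \<open>((I - P) \<otimes> I\<^sub>n) x\<close>.\<close>

definition disagreement :: "real^'v^'v \<Rightarrow> real^('v \<times> 'n) \<Rightarrow> real^('v::finite \<times> 'n::finite)" where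
  "disagreement P x = kronecker (mat 1 - P) (mat 1 :: real^'n^'n) *v x"


text \<open>Self-loops are allowed: a stochastic positive semidefinite matrix has a positive diagonal,
  so every node on which such a matrix is defined is its own neighbour.\<close>

definition connected_graph :: "('v \<times> 'v) set \<Rightarrow> bool" where
  "connected_graph E \<longleftrightarrow> sym E \<and> (\<forall>i j. (i, j) \<in> E\<^sup>*)"

definition neighbors :: "('v \<times> 'v) set \<Rightarrow> 'v \<Rightarrow> 'v set" where
  "neighbors E i = {j. (i, j) \<in> E}"

definition defined_on_graph :: "real^'v^'v \<Rightarrow> ('v::finite \<times> 'v) set \<Rightarrow> bool" where
  "defined_on_graph P E \<longleftrightarrow> (\<forall>i j. P $ i $ j > 0 \<longrightarrow> j \<in> neighbors E i)"

definition stochastic :: "real^'v^'v::finite \<Rightarrow> bool" where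
  "stochastic P \<longleftrightarrow> (\<forall>i j. 0 \<le> P $ i $ j) \<and> (\<forall>i. (\<Sum>j\<in>UNIV. P $ i $ j) = 1)"

text \<open>The matrix power is written as an iterated \<open>**\<close>, since \<open>*\<close> is entrywise on vectors.\<close>

definition irreducible_matrix :: "real^'v^'v::finite \<Rightarrow> bool" where
  "irreducible_matrix P \<longleftrightarrow> (\<forall>i j. \<exists>k. (((**) P ^^ k) (mat 1)) $ i $ j > 0)"

definition pos_semidef :: "real^'v^'v::finite \<Rightarrow> bool" where
  "pos_semidef P \<longleftrightarrow> (\<forall>v. 0 \<le> v \<bullet> (P *v v))"


definition ext_epigraph :: "('a \<Rightarrow> ereal) \<Rightarrow> ('a \<times> real) set" where
  "ext_epigraph f = {(u, r). f u \<le> ereal r}"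

definition closed_proper_convex :: "('a::real_normed_vector \<Rightarrow> ereal) \<Rightarrow> bool" where
  "closed_proper_convex f \<longleftrightarrow>
     closed (ext_epigraph f) \<and> convex (ext_epigraph f) \<and>
     (\<forall>u. f u \<noteq> -\<infinity>) \<and> (\<exists>u. f u \<noteq> \<infinity>)"

definition set_indicator :: "'a set \<Rightarrow> 'a \<Rightarrow> ereal" where
  "set_indicator X u = (if u \<in> X then 0 else \<infinity>)"

text \<open>The subdifferential is empty outside the effective domain; the finiteness condition keeps
  the difference below away from \<open>\<infinity> - \<infinity>\<close>, which has a value in \<open>ereal\<close>.\<close>

definition subdifferential :: "('a::real_inner \<Rightarrow> ereal) \<Rightarrow> 'a \<Rightarrow> 'a set" where
  "subdifferential f u =
     {g. \<bar>f u\<bar> \<noteq> \<infinity> \<and> (\<forall>v. ereal (g \<bullet> (v - u)) \<le> f v - f u)}"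


definition strictly_convex_on :: "'a::real_vector set \<Rightarrow> ('a \<Rightarrow> real) \<Rightarrow> bool" where
  "strictly_convex_on D \<phi> \<longleftrightarrow>
     (\<forall>u\<in>D. \<forall>v\<in>D. \<forall>s. u \<noteq> v \<longrightarrow> 0 < s \<longrightarrow> s < 1 \<longrightarrow>
        \<phi> ((1 - s) *\<^sub>R u + s *\<^sub>R v) < (1 - s) * \<phi> u + s * \<phi> v)"

definition gradient :: "('a::real_inner \<Rightarrow> real) \<Rightarrow> 'a \<Rightarrow> 'a" where
  "gradient \<phi> v = (THE g. GDERIV \<phi> v :> g)"

definition mirror_map :: "'a::euclidean_space set \<Rightarrow> ('a \<Rightarrow> real) \<Rightarrow> bool" where
  "mirror_map D \<phi> \<longleftrightarrow>
     (\<forall>v\<in>D. \<phi> differentiable (at v)) \<and>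
     strictly_convex_on D \<phi> \<and>
     gradient \<phi> ` D = UNIV \<and>
     (\<forall>b\<in>frontier (closure D). filterlim (\<lambda>v. norm (gradient \<phi> v)) at_top (at b within D))"

text \<open>A mirror map has values on \<open>D\<close> only, but the Bregman divergence is also evaluated with its
  first argument in the constraint set, hence in the closure of \<open>D\<close>.  As usual, a convex function
  on \<open>D\<close> is extended by its lower semicontinuous closure, which is \<open>\<infinity>\<close> off the closure of \<open>D\<close>
  (there \<open>at u within D\<close> is the trivial filter).\<close>

definition closure_extension :: "'a::euclidean_space set \<Rightarrow> ('a \<Rightarrow> real) \<Rightarrow> 'a \<Rightarrow> ereal" where
  "closure_extension D \<phi> u =
     (if u \<in> D then ereal (\<phi> u) else Liminf (at u within D) (\<lambda>v. ereal (\<phi> v)))"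

text \<open>Meaningful for \<open>v \<in> D\<close>.\<close>

definition bregman :: "'a::euclidean_space set \<Rightarrow> ('a \<Rightarrow> real) \<Rightarrow> 'a \<Rightarrow> 'a \<Rightarrow> ereal" where
  "bregman D \<phi> u v =
     closure_extension D \<phi> u - ereal (\<phi> v) - ereal (gradient \<phi> v \<bullet> (u - v))"

definition lp_norm :: "ereal \<Rightarrow> real^'n::finite \<Rightarrow> real" where
  "lp_norm p u =
     (if p = \<infinity> then Max (range (\<lambda>k. \<bar>u $ k\<bar>))
      else (\<Sum>k\<in>UNIV. \<bar>u $ k\<bar> powr real_of_ereal p) powr (1 / real_of_ereal p))"

definition bregman_strongly_convex ::
    "(real^'n::finite) set \<Rightarrow> (real^'n) set \<Rightarrow> (real^'n \<Rightarrow> real) \<Rightarrow> real \<Rightarrow> ereal \<Rightarrow> bool" where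
  "bregman_strongly_convex X D \<phi> \<alpha> p \<longleftrightarrow>
     (\<forall>u\<in>X. \<forall>v\<in>X \<inter> D. ereal (\<alpha> / 2 * (lp_norm p (u - v))\<^sup>2) \<le> bregman D \<phi> u v)"


definition saddle_point ::
    "('v::finite \<Rightarrow> real^'n::finite \<Rightarrow> ereal) \<Rightarrow> (real^'n) set \<Rightarrow> real^'v^'v \<Rightarrow>
     real^('v \<times> 'n) \<Rightarrow> real^('v \<times> 'n) \<Rightarrow> bool" where
  "saddle_point f X P x \<mu> \<longleftrightarrow>
     (\<forall>i. block x i \<in> X \<and>
          (\<Sum>j\<in>UNIV. P $ i $ j *\<^sub>R block x j) = block x i \<and>
          - block \<mu> i + (\<Sum>j\<in>UNIV. P $ i $ j *\<^sub>R block \<mu> j)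
            \<in> subdifferential (\<lambda>u. f i u + set_indicator X u) (block x i))"

definition lagrangian ::
    "('v::finite \<Rightarrow> real^'n::finite \<Rightarrow> ereal) \<Rightarrow> (real^'n) set \<Rightarrow> real^'v^'v \<Rightarrow>
     real^('v \<times> 'n) \<Rightarrow> real^('v \<times> 'n) \<Rightarrow> ereal" where
  "lagrangian f X P x \<mu> =
     (\<Sum>i\<in>UNIV. f i (block x i) + set_indicator X (block x i)) + ereal (\<mu> \<bullet> disagreement P x)"

definition lyapunov_H ::
    "('v::finite \<Rightarrow> real^'n::finite \<Rightarrow> ereal) \<Rightarrow> (real^'n) set \<Rightarrow> real^'v^'v \<Rightarrow> real \<Rightarrow>
     real^('v \<times> 'n) \<Rightarrow> real^('v \<times> 'n) \<Rightarrow> real^('v \<times> 'n) \<Rightarrow> real^('v \<times> 'n) \<Rightarrow> ereal" where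
  "lyapunov_H f X P \<tau> xs \<mu>s x \<mu> =
     lagrangian f X P x \<mu> - lagrangian f X P xs \<mu>s - ereal (\<tau> * (norm (disagreement P x))\<^sup>2)"

fun previous_dual ::
    "real^'v^'v \<Rightarrow> real \<Rightarrow> (nat \<Rightarrow> real^('v::finite \<times> 'n::finite)) \<Rightarrow> (nat \<Rightarrow> real^('v \<times> 'n)) \<Rightarrow>
     nat \<Rightarrow> real^('v \<times> 'n)" where
  "previous_dual P \<tau> x \<mu> 0 = \<mu> 0 - \<tau> *\<^sub>R disagreement P (x 0)"
| "previous_dual P \<tau> x \<mu> (Suc t) = \<mu> t"

definition lyapunov_V ::
    "('v::finite \<Rightarrow> real^'n::finite \<Rightarrow> ereal) \<Rightarrow> (real^'n) set \<Rightarrow> (real^'n) set \<Rightarrow>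
     (real^'n \<Rightarrow> real) \<Rightarrow> real^'v^'v \<Rightarrow> real \<Rightarrow> real \<Rightarrow> real \<Rightarrow>
     real^('v \<times> 'n) \<Rightarrow> real^('v \<times> 'n) \<Rightarrow>
     (nat \<Rightarrow> real^('v \<times> 'n)) \<Rightarrow> (nat \<Rightarrow> real^('v \<times> 'n)) \<Rightarrow> nat \<Rightarrow> ereal" where
  "lyapunov_V f X D \<phi> P \<tau> \<rho> \<omega> xs \<mu>s x \<mu> t =
     lyapunov_H f X P \<tau> xs \<mu>s (x t) (\<mu> t)
     + ereal (\<omega> / (2 * \<tau>) * (norm (\<mu>s - previous_dual P \<tau> x \<mu> t))\<^sup>2)
     + ereal \<rho> * (\<Sum>i\<in>UNIV. bregman D \<phi> (block xs i) (block (x t) i))"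


text \<open>One run of the algorithm for a given sequence \<open>S 1, S 2, \<dots>\<close> of node sets; \<open>S 0\<close> is not used,
  and block \<open>i\<close> of \<open>y t\<close> is constrained only for \<open>i \<in> S (t + 1)\<close>.\<close>

definition stochastic_bpdmm ::
    "('v::finite \<times> 'v) set \<Rightarrow> real^'v^'v \<Rightarrow> ('v \<Rightarrow> real^'n::finite \<Rightarrow> ereal) \<Rightarrow>
     (real^'n) set \<Rightarrow> (real^'n) set \<Rightarrow> (real^'n \<Rightarrow> real) \<Rightarrow> real \<Rightarrow> real \<Rightarrow>
     (nat \<Rightarrow> 'v set) \<Rightarrow> (nat \<Rightarrow> real^('v \<times> 'n)) \<Rightarrow> (nat \<Rightarrow> real^('v \<times> 'n)) \<Rightarrow>
     (nat \<Rightarrow> real^('v \<times> 'n)) \<Rightarrow> bool" where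
  "stochastic_bpdmm E P f X D \<phi> \<tau> \<rho> S y x \<mu> \<longleftrightarrow>
     (\<forall>i. block (x 0) i \<in> X \<inter> D) \<and>
     (\<forall>t.
       (\<forall>i \<in> S (Suc t).
          is_arg_min
            (\<lambda>z. \<Sum>j\<in>neighbors E i. ereal (P $ i $ j) * bregman D \<phi> z (block (x t) j))
            (\<lambda>z. z \<in> X) (block (y t) i)) \<and>
       (\<forall>i \<in> S (Suc t).
          is_arg_min
            (\<lambda>z. f i z
                 + ereal (z \<bullet> (block (\<mu> t) i - (\<Sum>j\<in>neighbors E i. P $ i $ j *\<^sub>R block (\<mu> t) j)))
                 + ereal \<rho> * bregman D \<phi> z (block (y t) i))
            (\<lambda>z. z \<in> X) (block (x (Suc t)) i)) \<and>
       (\<forall>i. i \<notin> S (Suc t) \<longrightarrow> block (x (Suc t)) i = block (x t) i) \<and>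
       (\<forall>i. block (\<mu> (Suc t)) i =
             block (\<mu> t) i + \<tau> *\<^sub>R block (x (Suc t)) i
             - \<tau> *\<^sub>R (\<Sum>j\<in>neighbors E i. P $ i $ j *\<^sub>R block (x (Suc t)) j)))"

text \<open>The node sets \<open>S 1, S 2, \<dots>\<close> are drawn independently and uniformly among the sets containing
  a fraction \<open>\<omega>\<close> of the nodes.\<close>

definition random_node_sets :: "'w measure \<Rightarrow> real \<Rightarrow> (nat \<Rightarrow> 'w \<Rightarrow> 'v::finite set) \<Rightarrow> bool" where
  "random_node_sets M \<omega> S \<longleftrightarrow>
     prob_space.indep_vars M (\<lambda>_. count_space UNIV) S {1..} \<and>
     (\<forall>t\<ge>1. (\<forall>w\<in>space M. real (card (S t w)) / real CARD('v) = \<omega>) \<and>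
        distr M (count_space UNIV) (S t) =
          measure_pmf (pmf_of_set {A. real (card A) / real CARD('v) = \<omega>}))"

text \<open>The expectation of an extended real random variable, as positive minus negative part
  (\<open>e2ennreal\<close> sends negative numbers to \<open>0\<close>).\<close>

definition ereal_expectation :: "'w measure \<Rightarrow> ('w \<Rightarrow> ereal) \<Rightarrow> ereal" where
  "ereal_expectation M Z =
     enn2ereal (\<integral>\<^sup>+ w. e2ennreal (Z w) \<partial>M) - enn2ereal (\<integral>\<^sup>+ w. e2ennreal (- Z w) \<partial>M)"

definition running_average :: "(nat \<Rightarrow> 'a::real_vector) \<Rightarrow> nat \<Rightarrow> 'a" where
  "running_average x T = (1 / real T) *\<^sub>R (\<Sum>t<T. x t)"

end

theory Submission
  imports Defs
begin

text \<open>Since \<open>\<mu>\<^sup>t = \<mu>\<^bsup>t-1\<^esup> + \<tau> Q x\<^sup>t\<close>, the Lyapunov function \<open>V(t)\<close> is separable in the blocks of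
  \<open>x\<^sup>t\<close> once it is written in terms of \<open>\<mu>\<^bsup>t-1\<^esup>\<close>.  Its conditional expectation after a random step is
  therefore the mixture, with weights \<open>\<omega>\<close> and \<open>1 - \<omega>\<close>, of its values at the fully updated and at
  the old iterate.  The three-point identity for both argmin updates, strong convexity, and
  \<open>\<Sum>\<^sub>i\<^sub>j P\<^sub>i\<^sub>j \<parallel>y\<^sub>i - x\<^sub>j\<parallel>\<^sup>2 \<ge> \<parallel>Q x\<parallel>\<^sup>2\<close> (which holds because \<open>0 \<le> P \<le> I\<close>) bound the full update, so that
  \<open>V(t) - E V(t+1) \<ge> \<omega> (L(x\<^sup>t,\<mu>\<^sup>*) - L(x\<^sup>*,\<mu>\<^sup>*)) + \<gamma>\<rho>/2 \<parallel>Q x\<^sup>t\<parallel>\<^sup>2\<close>.  Telescoping with \<open>V \<ge> 0\<close> and convexity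
  conclude.  If \<open>V(0) = \<infinity>\<close> there is nothing to prove; otherwise every \<open>f\<^sub>i\<close> is finite at a point of
  \<open>X \<inter> D\<close>, and the blow-up of \<open>\<nabla>\<phi>\<close> keeps all iterates in \<open>D\<close>.\<close>

section \<open>Mirror maps and Bregman proximal steps\<close>

text \<open>The iterates are arbitrary functions on the sample space, with no measurability given,
  and a run performs the two minimizations only at the drawn nodes. Uniqueness of the minimizers
  settles both difficulties. It makes the state at time t a function of the finitely many possible
  draws up to t, so expectations are finite sums, and a conditional expectation is an average over
  the one-draw continuations of a history, each realized by a sample point because it has positive
  probability. It also supplies the fully updated iterate, which in general no single draw produces:
  it is glued from blocks of different continuations, since every node lies in some admissible set
  and its new block does not depend on which one. The minimizers exist because the runs provide
  them. Uniqueness in turn relies on the iterates staying in \<open>D\<close>, where the mirror map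
  is differentiable and optimality becomes a variational inequality.\<close>

lemma GDERIV_directional:
  fixes f :: "'a::real_inner \<Rightarrow> real"
  assumes "GDERIV f v :> d"
  shows "((\<lambda>s. (f (v + s *\<^sub>R h) - f v) / s) \<longlongrightarrow> d \<bullet> h) (at_right 0)"
proof -
  have "(f has_derivative (\<lambda>k. k \<bullet> d)) (at (v + 0 *\<^sub>R h))"
    using assms by (simp add: gderiv_def)
  moreover have "((\<lambda>s. v + s *\<^sub>R h) has_derivative (\<lambda>s. s *\<^sub>R h)) (at 0)"
    by (auto intro!: derivative_eq_intros)
  ultimately have "((\<lambda>s. f (v + s *\<^sub>R h)) has_derivative (\<lambda>s. (s *\<^sub>R h) \<bullet> d)) (at 0)"
    using has_derivative_compose by blast
  then have "((\<lambda>s. f (v + s *\<^sub>R h)) has_field_derivative (d \<bullet> h)) (at 0)"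
    unfolding has_field_derivative_def by (simp add: inner_commute mult.commute[of _ "d \<bullet> h"])
  then have "((\<lambda>s. (f (v + s *\<^sub>R h) - f v) / s) \<longlongrightarrow> d \<bullet> h) (at 0)"
    by (simp add: has_field_derivative_iff)
  then show ?thesis
    using filterlim_at_split by blast
qed

text \<open>Convexity tested only at points of finite value, so that the inequality is one between
  reals; the finiteness clause says that these points form a convex set. It covers the f_i and also
  the zero function, which plays the role of G in the y update.\<close>

definition ext_convex :: "('a::real_vector \<Rightarrow> ereal) \<Rightarrow> bool" where
  "ext_convex G \<longleftrightarrow> (\<forall>u v s. \<bar>G u\<bar> \<noteq> \<infinity> \<longrightarrow> \<bar>G v\<bar> \<noteq> \<infinity> \<longrightarrow> 0 \<le> s \<longrightarrow> s \<le> 1 \<longrightarrow>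
     \<bar>G ((1 - s) *\<^sub>R u + s *\<^sub>R v)\<bar> \<noteq> \<infinity> \<and>
     real_of_ereal (G ((1 - s) *\<^sub>R u + s *\<^sub>R v))
       \<le> (1 - s) * real_of_ereal (G u) + s * real_of_ereal (G v))"

lemma closed_proper_convex_ext_convex:
  assumes "closed_proper_convex f"
  shows "ext_convex f"
  unfolding ext_convex_def
proof (intro allI impI)
  fix u v and s :: real
  assume fin: "\<bar>f u\<bar> \<noteq> \<infinity>" "\<bar>f v\<bar> \<noteq> \<infinity>" and s: "0 \<le> s" "s \<le> 1"
  obtain a b where ab: "f u = ereal a" "f v = ereal b" using fin by auto
  let ?z = "(1 - s) *\<^sub>R u + s *\<^sub>R v"
  have "convex (ext_epigraph f)" and ninf: "f ?z \<noteq> -\<infinity>"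
    using assms by (auto simp: closed_proper_convex_def)
  then have "(1 - s) *\<^sub>R (u, a) + s *\<^sub>R (v, b) \<in> ext_epigraph f"
    using ab s by (intro convexD) (auto simp: ext_epigraph_def)
  then have "f ?z \<le> ereal ((1 - s) * a + s * b)"
    by (simp add: ext_epigraph_def)
  then show "\<bar>f ?z\<bar> \<noteq> \<infinity> \<and>
      real_of_ereal (f ?z) \<le> (1 - s) * real_of_ereal (f u) + s * real_of_ereal (f v)"
    using ab ninf by (cases "f ?z") auto
qed

text \<open>The minimizers of \<open>G + \<rho> (\<Phi> - \<langle>c, \<cdot>\<rangle>)\<close> over \<open>X\<close>; both updates of the algorithm have this
  form, up to an additive constant.\<close>

definition is_prox ::
    "'a::real_inner set \<Rightarrow> ('a \<Rightarrow> ereal) \<Rightarrow> ('a \<Rightarrow> ereal) \<Rightarrow> real \<Rightarrow> 'a \<Rightarrow> 'a \<Rightarrow> bool" where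
  "is_prox X G \<Phi> \<rho> c z \<longleftrightarrow> z \<in> X \<and> \<bar>G z\<bar> \<noteq> \<infinity> \<and> \<bar>\<Phi> z\<bar> \<noteq> \<infinity> \<and>
     (\<forall>u\<in>X. \<bar>G u\<bar> \<noteq> \<infinity> \<longrightarrow> \<bar>\<Phi> u\<bar> \<noteq> \<infinity> \<longrightarrow>
        real_of_ereal (G z) + \<rho> * (real_of_ereal (\<Phi> z) - c \<bullet> z)
          \<le> real_of_ereal (G u) + \<rho> * (real_of_ereal (\<Phi> u) - c \<bullet> u))"

locale mirror_space =
  fixes X D :: "'a::euclidean_space set" and \<phi> :: "'a \<Rightarrow> real"
  assumes convex_X: "convex X"
    and open_D: "open D" and convex_D: "convex D" and X_subset: "X \<subseteq> closure D"
    and mirror: "mirror_map D \<phi>"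
begin

abbreviation "\<Phi> \<equiv> closure_extension D \<phi>"

lemma GDERIV_gradient:
  assumes "v \<in> D"
  shows "GDERIV \<phi> v :> gradient \<phi> v"
proof -
  have "\<phi> differentiable (at v)" using mirror assms by (auto simp: mirror_map_def)
  then obtain f' where f': "(\<phi> has_derivative f') (at v)" by (auto simp: differentiable_def)
  then have lin: "linear f'" using has_derivative_linear by blast
  define d where "d = (\<Sum>b\<in>Basis. f' b *\<^sub>R b)"
  have "f' h = h \<bullet> d" for h
  proof -
    have "f' h = f' (\<Sum>b\<in>Basis. (h \<bullet> b) *\<^sub>R b)" by (simp add: euclidean_representation)
    also have "\<dots> = (\<Sum>b\<in>Basis. (h \<bullet> b) * f' b)"
      by (simp add: linear_sum[OF lin] linear_scale[OF lin])
    finally show ?thesis by (simp add: d_def inner_sum_right mult.commute)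
  qed
  then have "f' = (\<lambda>h. h \<bullet> d)" by auto
  with f' have d: "GDERIV \<phi> v :> d" by (simp add: gderiv_def)
  moreover have "d' = d" if "GDERIV \<phi> v :> d'" for d'
  proof -
    have "(\<lambda>h. h \<bullet> d') = (\<lambda>h. h \<bullet> d)"
      using that d has_derivative_unique unfolding gderiv_def by blast
    then show ?thesis by (metis vector_eq_ldot)
  qed
  ultimately show ?thesis unfolding gradient_def by (rule theI)
qed

text \<open>By convexity the difference quotient at v in direction u - v never exceeds \<phi> u -
  \<phi> v; the limit s \<rightarrow> 0 gives the claim.\<close>

lemma gradient_inequality:
  assumes "u \<in> D" "v \<in> D"
  shows "\<phi> v + gradient \<phi> v \<bullet> (u - v) \<le> \<phi> u"
proof (cases "u = v")
  case False
  have lim: "((\<lambda>s. (\<phi> (v + s *\<^sub>R (u - v)) - \<phi> v) / s) \<longlongrightarrow> gradient \<phi> v \<bullet> (u - v)) (at_right 0)"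
    by (rule GDERIV_directional[OF GDERIV_gradient[OF assms(2)]])
  have "\<forall>\<^sub>F s in at_right 0. (\<phi> (v + s *\<^sub>R (u - v)) - \<phi> v) / s \<le> \<phi> u - \<phi> v"
    unfolding eventually_at_right_field
  proof (intro exI[of _ 1] conjI allI impI)
    fix s :: real assume s: "0 < s" "s < 1"
    have "strictly_convex_on D \<phi>" using mirror by (auto simp: mirror_map_def)
    then have "\<phi> ((1 - s) *\<^sub>R v + s *\<^sub>R u) < (1 - s) * \<phi> v + s * \<phi> u"
      using assms s False by (simp add: strictly_convex_on_def)
    moreover have "(1 - s) *\<^sub>R v + s *\<^sub>R u = v + s *\<^sub>R (u - v)" by (simp add: algebra_simps)
    ultimately have "\<phi> (v + s *\<^sub>R (u - v)) - \<phi> v \<le> s * (\<phi> u - \<phi> v)"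
      by (simp add: algebra_simps)
    then show "(\<phi> (v + s *\<^sub>R (u - v)) - \<phi> v) / s \<le> \<phi> u - \<phi> v"
      using s by (simp add: field_simps)
  qed simp
  then have "gradient \<phi> v \<bullet> (u - v) \<le> \<phi> u - \<phi> v"
    by (intro tendsto_upperbound[OF lim]) auto
  then show ?thesis by simp
qed simp

lemma closure_extension_eq: "u \<in> D \<Longrightarrow> \<Phi> u = ereal (\<phi> u)"
  by (simp add: closure_extension_def)

lemma gradient_inequality_ext:
  assumes "v \<in> D"
  shows "ereal (\<phi> v + gradient \<phi> v \<bullet> (u - v)) \<le> \<Phi> u"
\<comment> \<open>Along the trivial filter the Liminf is \<infinity>. In the remaining case the
  affine minorant is continuous and passes to the Liminf.\<close>
proof (cases "u \<in> D \<or> at u within D = bot")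
  case True
  then show ?thesis
    using gradient_inequality[of u v] assms by (auto simp: closure_extension_def)
next
  case False
  let ?h = "\<lambda>w. ereal (\<phi> v + gradient \<phi> v \<bullet> (w - v))"
  have "(?h \<longlongrightarrow> ?h u) (at u within D)"
    by (intro tendsto_intros)
  then have "?h u = Liminf (at u within D) ?h"
    using False lim_imp_Liminf by metis
  also have "\<dots> \<le> Liminf (at u within D) (\<lambda>w. ereal (\<phi> w))"
    by (rule Liminf_mono)
      (use gradient_inequality assms in \<open>auto simp: eventually_at_filter\<close>)
  also have "\<dots> = \<Phi> u" using False by (simp add: closure_extension_def)
  finally show ?thesis .
qed

lemma closure_extension_not_MInf:
  assumes "v \<in> D"
  shows "\<Phi> u \<noteq> -\<infinity>"
  using gradient_inequality_ext[OF assms, of u] by auto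

lemma gradient_inequality_real:
  assumes "v \<in> D" "\<bar>\<Phi> u\<bar> \<noteq> \<infinity>"
  shows "\<phi> v + gradient \<phi> v \<bullet> (u - v) \<le> real_of_ereal (\<Phi> u)"
  using gradient_inequality_ext[OF assms(1), of u] assms(2) by (cases "\<Phi> u") auto

lemma continuous_on_potential: "continuous_on D \<phi>"
  using mirror by (auto simp: mirror_map_def intro!: continuous_at_imp_continuous_on
      differentiable_imp_continuous_within)

text \<open>On a segment from a boundary point into \<open>D\<close>, the blow-up of the gradient forces the slope of
  \<open>\<phi>\<close> at the boundary to be \<open>-\<infinity>\<close>, so that no boundary point can be a minimizer.\<close>

lemma boundary_slope:
  assumes z: "z \<in> closure D" "z \<notin> D" and u: "u \<in> D"
  obtains s where "0 < s" "s < 1" "(1 - s) *\<^sub>R z + s *\<^sub>R u \<in> D"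
    "gradient \<phi> ((1 - s) *\<^sub>R z + s *\<^sub>R u) \<bullet> (u - z) < C"
proof -
  define zs where "zs s = (1 - s) *\<^sub>R z + s *\<^sub>R u" for s :: real
  have in_D: "zs s \<in> D" if "0 < s" "s \<le> 1" for s
  proof -
    have "z - s *\<^sub>R (z - u) \<in> interior D"
      using mem_interior_closure_convex_shrink[OF convex_D _ z(1) that, of u] u open_D
      by (simp add: interior_open)
    then show ?thesis
      using open_D by (simp add: zs_def interior_open algebra_simps)
  qed
  \<comment> \<open>An open convex set is the interior of its closure, so z lies on the frontier
    where the gradient blows up.\<close>
  have "z \<in> frontier (closure D)"
    using z open_D convex_D by (simp add: frontier_def convex_interior_closure interior_open)
  then have blow: "filterlim (\<lambda>v. norm (gradient \<phi> v)) at_top (at z within D)"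
    using mirror by (auto simp: mirror_map_def)
  have "(zs \<longlongrightarrow> zs 0) (at_right 0)"
    unfolding zs_def by (intro tendsto_intros)
  moreover have "\<forall>\<^sub>F s in at_right 0. zs s \<in> D"
    unfolding eventually_at_right_field using in_D by (intro exI[of _ 1]) auto
  ultimately have "filterlim zs (at z within D) (at_right 0)"
    using z(2) unfolding filterlim_at by (auto simp: zs_def elim!: eventually_mono)
  from filterlim_compose[OF blow this]
  have lim: "filterlim (\<lambda>s. norm (gradient \<phi> (zs s))) at_top (at_right 0)" .
  obtain r where r: "r > 0" "cball u r \<subseteq> D"
    using u open_D open_contains_cball by blast
  have "compact (\<phi> ` cball u r)"
    using continuous_on_potential r by (intro compact_continuous_image) (auto intro: continuous_on_subset)
  then obtain B where B: "\<And>v. v \<in> cball u r \<Longrightarrow> \<bar>\<phi> v\<bar> \<le> B"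
    using compact_imp_bounded bounded_iff by (metis image_eqI real_norm_def)
  define K where "K = B - \<phi> u + norm (gradient \<phi> u) * norm (u - z)"
  \<comment> \<open>The test point u' is the point of the ball around u farthest in the direction of
    the gradient. It gains \<open>r * norm ?g\<close> in the gradient inequality at
    \<open>zs s\<close>, while \<phi> is at most \<open>B\<close> on the ball and, along the
    segment, above its tangent at u.\<close>
  have slope: "gradient \<phi> (zs s) \<bullet> (u - zs s) \<le> K - r * norm (gradient \<phi> (zs s))"
    if s: "0 < s" "s < 1" for s
  proof -
    let ?g = "gradient \<phi> (zs s)"
    define u' where "u' = u + r *\<^sub>R sgn ?g"
    have u': "u' \<in> cball u r" using r(1) by (simp add: u'_def dist_norm norm_sgn)
    have "\<phi> (zs s) + ?g \<bullet> (u' - zs s) \<le> \<phi> u'"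
      using gradient_inequality[of u' "zs s"] u' r in_D s by auto
    moreover have "?g \<bullet> (u' - zs s) = ?g \<bullet> (u - zs s) + r * norm ?g"
    proof -
      have "?g \<bullet> sgn ?g = norm ?g"
        by (cases "?g = 0") (auto simp: sgn_div_norm power2_norm_eq_inner[symmetric] power2_eq_square)
      then show ?thesis by (simp add: u'_def inner_diff_right inner_add_right)
    qed
    moreover have "\<phi> u' \<le> B" using B[OF u'] by simp
    moreover have "\<phi> u + gradient \<phi> u \<bullet> (zs s - u) \<le> \<phi> (zs s)"
      using gradient_inequality[of "zs s" u] u in_D s by auto
    moreover have "- (gradient \<phi> u \<bullet> (zs s - u)) \<le> norm (gradient \<phi> u) * norm (u - z)"
    proof -
      have "zs s - u = (1 - s) *\<^sub>R (z - u)" by (simp add: zs_def algebra_simps)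
      then have "norm (zs s - u) \<le> norm (u - z)"
        using s by (simp add: norm_minus_commute mult_left_le_one_le)
      then have "norm (gradient \<phi> u) * norm (zs s - u) \<le> norm (gradient \<phi> u) * norm (u - z)"
        by (intro mult_left_mono) auto
      then show ?thesis
        using Cauchy_Schwarz_ineq2[of "gradient \<phi> u" "zs s - u"] by linarith
    qed
    ultimately show ?thesis unfolding K_def by linarith
  qed
  have "\<forall>\<^sub>F s in at_right 0. norm (gradient \<phi> (zs s)) \<ge> (\<bar>K\<bar> + \<bar>C\<bar> + 1) / r"
    using lim by (auto simp: filterlim_at_top)
  moreover have "\<forall>\<^sub>F s in at_right (0::real). 0 < s \<and> s < 1"
    unfolding eventually_at_right_field by (intro exI[of _ 1]) auto
  ultimately have "\<forall>\<^sub>F s in at_right 0. norm (gradient \<phi> (zs s)) \<ge> (\<bar>K\<bar> + \<bar>C\<bar> + 1) / r \<and> 0 < s \<and> s < 1"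
    by eventually_elim auto
  then obtain s where s: "norm (gradient \<phi> (zs s)) \<ge> (\<bar>K\<bar> + \<bar>C\<bar> + 1) / r" "0 < s" "s < 1"
    using eventually_happens trivial_limit_at_right_real by blast
  \<comment> \<open>The threshold pushes the slope to at most -\<bar>C\<bar> - 1, which is below (1
    - s) * C for every s in (0,1), so the factor 1 - s between \<open>u - zs s\<close> and
    \<open>u - z\<close> does no harm.\<close>
  have "\<bar>K\<bar> + \<bar>C\<bar> + 1 \<le> r * norm (gradient \<phi> (zs s))"
    using s(1) r(1) by (simp add: field_simps)
  then have neg: "gradient \<phi> (zs s) \<bullet> (u - zs s) \<le> - \<bar>C\<bar> - 1"
    using slope[OF s(2,3)] by linarith
  have "u - zs s = (1 - s) *\<^sub>R (u - z)" by (simp add: zs_def algebra_simps)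
  then have "(1 - s) * (gradient \<phi> (zs s) \<bullet> (u - z)) \<le> - \<bar>C\<bar> - 1" using neg by simp
  moreover have "(1 - s) * C \<ge> - \<bar>C\<bar>"
  proof -
    have "\<bar>(1 - s) * C\<bar> \<le> \<bar>C\<bar>" using s by (simp add: abs_mult mult_left_le_one_le)
    then show ?thesis by linarith
  qed
  ultimately have "(1 - s) * (gradient \<phi> (zs s) \<bullet> (u - z)) < (1 - s) * C" by linarith
  then have "gradient \<phi> (zs s) \<bullet> (u - z) < C" using s by simp
  then show thesis using that[of s] s in_D[of s] by (simp add: zs_def)
qed

text \<open>From a boundary point, a step of length s towards u changes the terms other than \<Phi>
  by at most a fixed multiple of s, while \<Phi> can be made to fall more steeply than that,
  contradicting minimality.\<close>

lemma is_prox_in_D: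
  assumes prox: "is_prox X G \<Phi> \<rho> c z" and G: "ext_convex G" and \<rho>: "0 < \<rho>"
    and u: "u \<in> X" "u \<in> D" "\<bar>G u\<bar> \<noteq> \<infinity>"
  shows "z \<in> D"
proof (rule ccontr)
  assume "z \<notin> D"
  have z: "z \<in> X" "\<bar>G z\<bar> \<noteq> \<infinity>" "\<bar>\<Phi> z\<bar> \<noteq> \<infinity>" using prox by (auto simp: is_prox_def)
  let ?Gz = "real_of_ereal (G z)" and ?Gu = "real_of_ereal (G u)"
  \<comment> \<open>The bound on the slope is the break-even value: below it the fall of \<rho>
    \<Phi> outweighs the change of G and of the linear term.\<close>
  obtain s where s: "0 < s" "s < 1" and D: "(1 - s) *\<^sub>R z + s *\<^sub>R u \<in> D"
    and slope: "gradient \<phi> ((1 - s) *\<^sub>R z + s *\<^sub>R u) \<bullet> (u - z) < (?Gz - ?Gu) / \<rho> + c \<bullet> (u - z)"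
    using boundary_slope \<open>z \<notin> D\<close> z(1) X_subset u(2) by blast
  let ?w = "(1 - s) *\<^sub>R z + s *\<^sub>R u"
  have wX: "?w \<in> X" using convexD[OF convex_X z(1) u(1), of "1 - s" s] s by auto
  have Gw: "\<bar>G ?w\<bar> \<noteq> \<infinity>" "real_of_ereal (G ?w) \<le> (1 - s) * ?Gz + s * ?Gu"
    using G z u s unfolding ext_convex_def by auto
  have "?Gz + \<rho> * (real_of_ereal (\<Phi> z) - c \<bullet> z) \<le> real_of_ereal (G ?w) + \<rho> * (\<phi> ?w - c \<bullet> ?w)"
    using prox wX Gw(1) D by (auto simp: is_prox_def closure_extension_eq)
  moreover have "\<phi> ?w + gradient \<phi> ?w \<bullet> (z - ?w) \<le> real_of_ereal (\<Phi> z)"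
    by (rule gradient_inequality_real[OF D z(3)])
  then have "\<rho> * (\<phi> ?w + gradient \<phi> ?w \<bullet> (z - ?w)) \<le> \<rho> * real_of_ereal (\<Phi> z)"
    using \<rho> by simp
  moreover have "z - ?w = (- s) *\<^sub>R (u - z)" by (simp add: algebra_simps)
  then have "gradient \<phi> ?w \<bullet> (z - ?w) = - s * (gradient \<phi> ?w \<bullet> (u - z))"
    by (metis inner_scaleR_right)
  moreover have "c \<bullet> ?w = c \<bullet> z + s * (c \<bullet> (u - z))"
    by (simp add: inner_add_right inner_diff_right algebra_simps)
  ultimately have "s * (?Gz - ?Gu + \<rho> * (c \<bullet> (u - z)) - \<rho> * (gradient \<phi> ?w \<bullet> (u - z))) \<le> 0"
    using Gw(2) by (simp add: algebra_simps)
  then have "?Gz - ?Gu + \<rho> * (c \<bullet> (u - z)) \<le> \<rho> * (gradient \<phi> ?w \<bullet> (u - z))"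
    using s by (simp add: mult_le_0_iff)
  moreover have "\<rho> * (gradient \<phi> ?w \<bullet> (u - z)) < ?Gz - ?Gu + \<rho> * (c \<bullet> (u - z))"
    using mult_strict_left_mono[OF slope \<rho>] \<rho> by (simp add: distrib_left)
  ultimately show False by linarith
qed

text \<open>Minimality is tested at z + s (u - z), divided by s, and s tends to 0. Only points near
  z are tested, and these lie in the open set \<open>D\<close>; hence u itself may be a boundary
  point, as blocks of the saddle point can be.\<close>

lemma is_prox_variational:
  assumes prox: "is_prox X G \<Phi> \<rho> c z" and G: "ext_convex G" and zD: "z \<in> D"
    and u: "u \<in> X" "\<bar>G u\<bar> \<noteq> \<infinity>"
  shows "0 \<le> real_of_ereal (G u) - real_of_ereal (G z) + \<rho> * ((gradient \<phi> z - c) \<bullet> (u - z))"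
proof -
  have z: "z \<in> X" "\<bar>G z\<bar> \<noteq> \<infinity>" using prox by (auto simp: is_prox_def)
  let ?Gz = "real_of_ereal (G z)" and ?Gu = "real_of_ereal (G u)"
  let ?w = "\<lambda>s. z + s *\<^sub>R (u - z)"
  have "(?w \<longlongrightarrow> ?w 0) (at_right 0)" by (intro tendsto_intros)
  then have ev: "\<forall>\<^sub>F s in at_right 0. ?w s \<in> D"
    using open_D zD by (auto dest: topological_tendstoD)
  have "((\<lambda>s. (\<phi> (?w s) - \<phi> z) / s) \<longlongrightarrow> gradient \<phi> z \<bullet> (u - z)) (at_right 0)"
    by (rule GDERIV_directional[OF GDERIV_gradient[OF zD]])
  then have lim: "((\<lambda>s. ?Gu - ?Gz + \<rho> * ((\<phi> (?w s) - \<phi> z) / s - c \<bullet> (u - z)))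
      \<longlongrightarrow> ?Gu - ?Gz + \<rho> * (gradient \<phi> z \<bullet> (u - z) - c \<bullet> (u - z))) (at_right 0)"
    by (intro tendsto_intros)
  have ev01: "\<forall>\<^sub>F s in at_right (0::real). 0 < s \<and> s < 1"
    unfolding eventually_at_right_field by (intro exI[of _ 1]) auto
  have "\<forall>\<^sub>F s in at_right 0. 0 \<le> ?Gu - ?Gz + \<rho> * ((\<phi> (?w s) - \<phi> z) / s - c \<bullet> (u - z))"
    using ev ev01
  proof eventually_elim
    case (elim s)
    have eq: "(1 - s) *\<^sub>R z + s *\<^sub>R u = ?w s" by (simp add: algebra_simps)
    have wX: "?w s \<in> X" using convexD[OF convex_X z(1) u(1), of "1 - s" s] elim eq by auto
    have "\<bar>G ((1 - s) *\<^sub>R z + s *\<^sub>R u)\<bar> \<noteq> \<infinity> \<and>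
        real_of_ereal (G ((1 - s) *\<^sub>R z + s *\<^sub>R u)) \<le> (1 - s) * ?Gz + s * ?Gu"
      using G z u elim unfolding ext_convex_def by auto
    then have Gw: "\<bar>G (?w s)\<bar> \<noteq> \<infinity>" "real_of_ereal (G (?w s)) \<le> (1 - s) * ?Gz + s * ?Gu"
      unfolding eq by auto
    have "?Gz + \<rho> * (\<phi> z - c \<bullet> z) \<le> real_of_ereal (G (?w s)) + \<rho> * (\<phi> (?w s) - c \<bullet> ?w s)"
      using prox wX Gw(1) elim zD by (auto simp: is_prox_def closure_extension_eq)
    then have "0 \<le> s * (?Gu - ?Gz) + \<rho> * (\<phi> (?w s) - \<phi> z - s * (c \<bullet> (u - z)))"
      using Gw(2) by (simp add: algebra_simps inner_add_right)
    also have "\<dots> = s * (?Gu - ?Gz + \<rho> * ((\<phi> (?w s) - \<phi> z) / s - c \<bullet> (u - z)))"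
      using elim by (simp add: field_simps)
    finally show ?case using elim by (simp add: zero_le_mult_iff)
  qed
  then have "0 \<le> ?Gu - ?Gz + \<rho> * (gradient \<phi> z \<bullet> (u - z) - c \<bullet> (u - z))"
    by (intro tendsto_lowerbound[OF lim]) auto
  then show ?thesis by (simp add: inner_diff_left)
qed

text \<open>Real counterpart of \<open>bregman\<close>. Since \<open>real_of_ereal\<close> sends
  \<infinity> to 0, it has its intended meaning only where \<Phi> u is finite.\<close>

definition breg :: "'a \<Rightarrow> 'a \<Rightarrow> real" where
  "breg u v = real_of_ereal (\<Phi> u) - \<phi> v - gradient \<phi> v \<bullet> (u - v)"

lemma bregman_eq_breg:
  assumes "\<bar>\<Phi> u\<bar> \<noteq> \<infinity>"
  shows "bregman D \<phi> u v = ereal (breg u v)"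
  using assms by (cases "\<Phi> u") (auto simp: bregman_def breg_def)

lemma bregman_eq_PInfty:
  assumes "\<Phi> u = \<infinity>"
  shows "bregman D \<phi> u v = \<infinity>"
  using assms by (auto simp: bregman_def)

lemma three_point:
  assumes "z \<in> D"
  shows "(gradient \<phi> z - gradient \<phi> v) \<bullet> (u - z) = breg u v - breg u z - breg z v"
  using assms by (simp add: breg_def closure_extension_eq inner_diff_left inner_diff_right)

end

section \<open>Comparison of norms\<close>

text \<open>Bernoulli's inequality for real exponents, from weighted AM-GM with weights 1/r and 1 -
  1/r on \<open>t powr r\<close> and 1.\<close>

lemma powr_ge_tangent:
  fixes t r :: real
  assumes "0 \<le> t" "1 \<le> r"
  shows "1 + r * (t - 1) \<le> t powr r"
proof (cases "t = 0")
  case False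
  have "(t powr r) powr (1 / r) * 1 powr (1 - 1 / r) \<le> 1 / r * t powr r + (1 - 1 / r) * 1"
    using False assms by (intro Youngs_inequality_0) auto
  then have "r * t \<le> r * (1 / r * t powr r + (1 - 1 / r))"
    using assms by (intro mult_left_mono) (auto simp: powr_powr)
  also have "\<dots> = t powr r + (r - 1)" using assms by (simp add: field_simps)
  finally show ?thesis by (simp add: algebra_simps)
qed (use assms in auto)

text \<open>With s the l_q norm, every entry is at most s in modulus. Splitting a square into powers
  q and 2 - q and bounding the second factor by \<open>s powr (2 - q)\<close> makes the squares sum
  to at most \<open>s\<^sup>2\<close>.\<close>

lemma norm_le_lp_norm:
  fixes u :: "real^'n"
  assumes q: "1 \<le> q" "q \<le> 2"
  shows "norm u \<le> lp_norm (ereal q) u"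
proof -
  define A where "A = (\<Sum>k\<in>UNIV. \<bar>u $ k\<bar> powr q)"
  define s where "s = A powr (1 / q)"
  have A: "0 \<le> A" by (auto simp: A_def intro: sum_nonneg)
  have s0: "0 \<le> s" by (simp add: s_def)
  have sq: "s powr q = A" using A q by (simp add: s_def powr_powr)
  have le: "\<bar>u $ k\<bar> \<le> s" for k
  proof -
    have "\<bar>u $ k\<bar> powr q \<le> A" unfolding A_def by (rule member_le_sum) auto
    then have "(\<bar>u $ k\<bar> powr q) powr (1 / q) \<le> s"
      unfolding s_def using q by (intro powr_mono2) auto
    then show ?thesis using q by (simp add: powr_powr)
  qed
  have sqr: "(a::real)\<^sup>2 = a powr q * a powr (2 - q)" if "0 \<le> a" for a
    using that by (simp flip: powr_add add: powr_numeral)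
  have "(norm u)\<^sup>2 = (\<Sum>k\<in>UNIV. \<bar>u $ k\<bar>\<^sup>2)"
    by (simp add: norm_vec_def L2_set_def sum_nonneg)
  also have "\<dots> = (\<Sum>k\<in>UNIV. \<bar>u $ k\<bar> powr q * \<bar>u $ k\<bar> powr (2 - q))"
    by (simp only: sqr[OF abs_ge_zero])
  also have "\<dots> \<le> (\<Sum>k\<in>UNIV. \<bar>u $ k\<bar> powr q * s powr (2 - q))"
    using le q by (intro sum_mono mult_left_mono powr_mono2) auto
  also have "\<dots> = s\<^sup>2"
    using sq sqr[OF s0] by (simp add: A_def flip: sum_distrib_right)
  finally show ?thesis
    using s0 by (simp add: lp_norm_def s_def A_def power2_le_iff_abs_le)
qed

text \<open>Jensen's inequality for the power q/2: the tangent bound is applied to the squared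
  entries divided by their mean m, so that the linear terms sum to zero.\<close>

lemma power_mean_le_lp_norm:
  fixes u :: "real^'n"
  assumes q: "2 \<le> q"
  shows "real CARD('n) powr (2 / q - 1) * (norm u)\<^sup>2 \<le> (lp_norm (ereal q) u)\<^sup>2"
proof (cases "u = 0")
  case False
  define n where "n = real CARD('n)"
  have n: "0 < n" by (simp add: n_def)
  define A where "A = (\<Sum>k\<in>UNIV. \<bar>u $ k\<bar> powr q)"
  define m where "m = (norm u)\<^sup>2 / n"
  have m: "0 < m" using False n by (simp add: m_def)
  have nm: "(\<Sum>k\<in>UNIV. \<bar>u $ k\<bar>\<^sup>2) = n * m"
    using n by (simp add: m_def norm_vec_def L2_set_def sum_nonneg)
  have "(\<Sum>k\<in>UNIV. 1 + q / 2 * (\<bar>u $ k\<bar>\<^sup>2 / m - 1)) \<le> (\<Sum>k\<in>UNIV. (\<bar>u $ k\<bar>\<^sup>2 / m) powr (q / 2))"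
    using q m by (intro sum_mono powr_ge_tangent) auto
  also have "(\<Sum>k\<in>UNIV. 1 + q / 2 * (\<bar>u $ k\<bar>\<^sup>2 / m - 1)) = n"
    using nm m by (simp add: sum.distrib sum_subtractf n_def flip: sum_distrib_left sum_divide_distrib)
  also have "(\<Sum>k\<in>UNIV. (\<bar>u $ k\<bar>\<^sup>2 / m) powr (q / 2)) = A / m powr (q / 2)"
  proof -
    have "(\<bar>u $ k\<bar>\<^sup>2) powr (q / 2) = \<bar>u $ k\<bar> powr q" for k
      using powr_powr[of "\<bar>u $ k\<bar>" 2 "q / 2"] by simp
    then show ?thesis using m by (simp add: powr_divide A_def sum_divide_distrib)
  qed
  finally have "n * m powr (q / 2) \<le> A" using m by (simp add: field_simps)
  then have "(n * m powr (q / 2)) powr (2 / q) \<le> A powr (2 / q)"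
    using q n by (intro powr_mono2) auto
  moreover have "(n * m powr (q / 2)) powr (2 / q) = n powr (2 / q) * m"
    using q m n by (simp add: powr_mult powr_powr)
  moreover have "A powr (2 / q) = (A powr (1 / q))\<^sup>2"
    using q by (simp add: powr_powr flip: powr_numeral)
  moreover have "n powr (2 / q) * m = n powr (2 / q - 1) * (norm u)\<^sup>2"
    using n by (simp add: m_def powr_diff)
  ultimately show ?thesis by (simp add: lp_norm_def A_def n_def)
qed simp

lemma norm_le_lp_norm_infinity:
  fixes u :: "real^'n"
  shows "(norm u)\<^sup>2 \<le> real CARD('n) * (lp_norm \<infinity> u)\<^sup>2"
proof -
  have "\<bar>u $ k\<bar> \<le> lp_norm \<infinity> u" for k
    by (simp add: lp_norm_def)
  then have "(\<Sum>k\<in>UNIV. \<bar>u $ k\<bar>\<^sup>2) \<le> (\<Sum>k\<in>(UNIV::'n set). (lp_norm \<infinity> u)\<^sup>2)"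
    by (intro sum_mono power_mono) auto
  then show ?thesis by (simp add: norm_vec_def L2_set_def sum_nonneg)
qed

text \<open>The origin of \<sigma>: it converts strong convexity in the l_p norm into strong
  convexity in the Euclidean norm. The factor 1 serves p \<le> 2, the power of the dimension serves
  p > 2.\<close>

lemma lp_norm_ge:
  fixes u :: "real^'n"
  assumes p: "1 \<le> p"
  shows "min 1 (real CARD('n) powr real_of_ereal (2 / p - 1)) * (norm u)\<^sup>2 \<le> (lp_norm p u)\<^sup>2"
    (is "min 1 ?c * _ \<le> _")
proof (cases p)
  case (real q)
  have c: "?c = real CARD('n) powr (2 / q - 1)"
    using real p unfolding numeral_eq_ereal one_ereal_def by auto
  show ?thesis
  proof (cases "q \<le> 2")
    case True
    have "min 1 ?c * (norm u)\<^sup>2 \<le> 1 * (norm u)\<^sup>2" by (intro mult_right_mono) auto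
    also have "\<dots> \<le> (lp_norm p u)\<^sup>2"
      using norm_le_lp_norm[of q u] True real p by (simp add: power_mono)
    finally show ?thesis .
  next
    case False
    have "min 1 ?c * (norm u)\<^sup>2 \<le> ?c * (norm u)\<^sup>2" by (intro mult_right_mono) auto
    also have "\<dots> \<le> (lp_norm p u)\<^sup>2"
      using power_mean_le_lp_norm[of q u] False real c by simp
    finally show ?thesis .
  qed
next
  case PInf
  \<comment> \<open>In \<open>ereal\<close>, 2 / \<infinity> = 0, so the exponent is -1.\<close>
  have "?c = 1 / real CARD('n)" using PInf by (simp add: powr_minus_divide)
  then have "min 1 ?c * (norm u)\<^sup>2 \<le> 1 / real CARD('n) * (norm u)\<^sup>2"
    by (intro mult_right_mono) auto
  also have "\<dots> \<le> (lp_norm p u)\<^sup>2"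
    using norm_le_lp_norm_infinity[of u] PInf by (simp add: field_simps)
  finally show ?thesis .
qed (use p in auto)

section \<open>Mixing with a stochastic matrix\<close>

locale contraction =
  fixes A :: "'a::real_inner \<Rightarrow> 'a"
  assumes lin: "linear A"
    and self_adjoint: "A u \<bullet> v = u \<bullet> A v"
    and nonneg: "0 \<le> u \<bullet> A u"
    and le_id: "u \<bullet> A u \<le> u \<bullet> u"
begin

lemmas A_simps = linear_add[OF lin] linear_diff[OF lin] linear_scale[OF lin]

text \<open>With \<open>Q = I - A\<close>, the identity behind this is \<open>A Q = Q A Q + A Q A\<close>.\<close>

lemma inner_A_complement_nonneg: "0 \<le> A u \<bullet> (u - A u)"
proof -
  have "A u \<bullet> (u - A u) = (u - A u) \<bullet> A (u - A u) + (A u \<bullet> A u - A u \<bullet> A (A u))"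
    by (simp add: A_simps inner_diff_left inner_diff_right inner_commute self_adjoint)
  then show ?thesis using nonneg[of "u - A u"] le_id[of "A u"] by simp
qed

lemma norm_complement_le: "norm (u - A u) \<le> norm u"
proof -
  have "(norm (u - A u))\<^sup>2 = (norm u)\<^sup>2 - u \<bullet> A u - A u \<bullet> (u - A u)"
    by (simp add: power2_norm_eq_inner inner_diff_left inner_diff_right inner_commute)
  also have "\<dots> \<le> (norm u)\<^sup>2" using nonneg[of u] inner_A_complement_nonneg[of u] by simp
  finally show ?thesis by (simp add: power2_le_iff_abs_le)
qed

text \<open>As a function of v the right side is smallest at v = A u, where it exceeds the left side
  by twice the nonnegative quantity of \<open>inner_A_complement_nonneg\<close>. For A =
  \<open>mixing P\<close> the right side is the spread in \<open>weighted_spread\<close>.\<close>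

lemma complement_le_spread:
  "(norm (u - A u))\<^sup>2 \<le> (norm v)\<^sup>2 - 2 * (v \<bullet> A u) + (norm u)\<^sup>2"
proof -
  have "(norm v)\<^sup>2 - 2 * (v \<bullet> A u) + (norm u)\<^sup>2 - (norm (u - A u))\<^sup>2
      = (norm (v - A u))\<^sup>2 + 2 * (A u \<bullet> (u - A u))"
    by (simp add: power2_norm_eq_inner inner_diff_left inner_diff_right inner_commute)
  then show ?thesis using inner_A_complement_nonneg[of u] by (smt (verit) zero_le_power2)
qed

end

section \<open>Block vectors and the action of P \<otimes> I\<close>

lemma inner_block: "u \<bullet> v = (\<Sum>i\<in>UNIV. block u i \<bullet> block v i)"
  unfolding inner_vec_def block_def
  by (simp add: sum.cartesian_product UNIV_Times_UNIV[symmetric] del: UNIV_Times_UNIV)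

lemma norm_block: "(norm u)\<^sup>2 = (\<Sum>i\<in>UNIV. (norm (block u i))\<^sup>2)"
  by (simp add: power2_norm_eq_inner inner_block[of u u])

lemma block_eqI: "(\<And>i. block u i = block v i) \<Longrightarrow> u = v"
  by (auto simp: block_def vec_eq_iff)

lemma block_linear [simp]:
  "block (u + v) i = block u i + block v i"
  "block (u - v) i = block u i - block v i"
  "block (c *\<^sub>R u) i = c *\<^sub>R block u i"
  "block 0 i = 0"
  by (auto simp: block_def vec_eq_iff)

lemma block_sum: "block (\<Sum>t\<in>A. g t) i = (\<Sum>t\<in>A. block (g t) i)"
  by (induction A rule: infinite_finite_induct) auto

definition unblock :: "('v::finite \<Rightarrow> real^'n::finite) \<Rightarrow> real^('v \<times> 'n)" where
  "unblock g = (\<chi> r. g (fst r) $ snd r)"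

lemma block_unblock [simp]: "block (unblock g) i = g i"
  by (simp add: block_def unblock_def)

text \<open>The action of P \<otimes> I in block form, so that \<open>disagreement P\<close> becomes
  the complement u - A u of a contraction A.\<close>

definition mixing :: "real^'v^'v \<Rightarrow> real^('v \<times> 'n) \<Rightarrow> real^('v::finite \<times> 'n::finite)" where
  "mixing P u = unblock (\<lambda>i. \<Sum>j\<in>UNIV. P $ i $ j *\<^sub>R block u j)"

lemma block_mixing: "block (mixing P u) i = (\<Sum>j\<in>UNIV. P $ i $ j *\<^sub>R block u j)"
  by (simp add: mixing_def)

lemma disagreement_eq:
  fixes u :: "real^('v::finite \<times> 'n::finite)"
  shows "disagreement P u = u - mixing P u"
proof (rule vec_eq_iff[THEN iffD2], rule allI)
  have delta: "(\<Sum>l\<in>UNIV. a * (mat 1 :: real^'m^'m) $ k $ l * v l) = a * v k"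
    for a and k :: "'m::finite" and v
  proof -
    have "(\<Sum>l\<in>UNIV. a * (mat 1 :: real^'m^'m) $ k $ l * v l) = (\<Sum>l\<in>UNIV. if k = l then a * v l else 0)"
      by (rule sum.cong) (auto simp: mat_def)
    then show ?thesis by (simp add: sum.delta')
  qed
  fix r :: "'v \<times> 'n"
  obtain i k where r: "r = (i, k)" by (cases r)
  have "disagreement P u $ r = (\<Sum>s\<in>UNIV. (mat 1 - P) $ i $ fst s * (mat 1 :: real^'n^'n) $ k $ snd s * u $ s)"
    by (simp add: disagreement_def kronecker_def matrix_vector_mult_def r)
  also have "\<dots> = (\<Sum>j\<in>UNIV. \<Sum>l\<in>UNIV. (mat 1 - P) $ i $ j * (mat 1 :: real^'n^'n) $ k $ l * u $ (j, l))"
    by (simp add: sum.cartesian_product UNIV_Times_UNIV[symmetric] split_def del: UNIV_Times_UNIV)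
  also have "\<dots> = (\<Sum>j\<in>UNIV. (mat 1 - P) $ i $ j * u $ (j, k))"
    by (simp add: delta)
  also have "\<dots> = (\<Sum>j\<in>UNIV. 1 * (mat 1 :: real^'v^'v) $ i $ j * u $ (j, k))
      - (\<Sum>j\<in>UNIV. P $ i $ j * u $ (j, k))"
    by (simp add: left_diff_distrib sum_subtractf)
  also have "\<dots> = u $ (i, k) - (\<Sum>j\<in>UNIV. P $ i $ j * u $ (j, k))"
    using delta[of 1 i "\<lambda>j. u $ (j, k)"] by simp
  also have "\<dots> = (u - mixing P u) $ r"
    by (simp add: r mixing_def unblock_def block_def)
  finally show "disagreement P u $ r = (u - mixing P u) $ r" .
qed

context
  fixes P :: "real^'v::finite^'v"
  assumes sym: "transpose P = P" and stoch: "stochastic P"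
begin

lemma sym_entry: "P $ i $ j = P $ j $ i"
  using sym by (metis transpose_def vec_lambda_beta)

lemma entry_nonneg: "0 \<le> P $ i $ j"
  using stoch by (auto simp: stochastic_def)

lemma row_sum: "(\<Sum>j\<in>UNIV. P $ i $ j) = 1"
  using stoch by (auto simp: stochastic_def)

lemma column_sum: "(\<Sum>i\<in>UNIV. P $ i $ j) = 1"
  using row_sum[of j] by (simp add: sym_entry)

lemma inner_mixing:
  "v \<bullet> mixing P u = (\<Sum>i\<in>UNIV. \<Sum>j\<in>UNIV. P $ i $ j * (block v i \<bullet> block u j))"
  by (simp add: inner_block block_mixing inner_sum_right)

lemma weighted_spread:
  "(\<Sum>i\<in>UNIV. \<Sum>j\<in>UNIV. P $ i $ j * (norm (block v i - block u j))\<^sup>2)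
     = (norm v)\<^sup>2 - 2 * (v \<bullet> mixing P u) + (norm u)\<^sup>2"
proof -
  have "(\<Sum>i\<in>UNIV. \<Sum>j\<in>UNIV. P $ i $ j * (norm (block v i - block u j))\<^sup>2)
      = (\<Sum>i\<in>UNIV. \<Sum>j\<in>UNIV. P $ i $ j * (norm (block v i))\<^sup>2)
        - 2 * (\<Sum>i\<in>UNIV. \<Sum>j\<in>UNIV. P $ i $ j * (block v i \<bullet> block u j))
        + (\<Sum>i\<in>UNIV. \<Sum>j\<in>UNIV. P $ i $ j * (norm (block u j))\<^sup>2)"
    by (simp add: power2_norm_eq_inner inner_diff_left inner_diff_right inner_commute
        algebra_simps sum.distrib sum_subtractf sum_distrib_left)
  also have "(\<Sum>i\<in>UNIV. \<Sum>j\<in>UNIV. P $ i $ j * (norm (block v i))\<^sup>2) = (norm v)\<^sup>2"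
    by (simp add: norm_block row_sum flip: sum_distrib_right)
  also have "(\<Sum>i\<in>UNIV. \<Sum>j\<in>UNIV. P $ i $ j * (norm (block u j))\<^sup>2) = (norm u)\<^sup>2"
    by (subst sum.swap) (simp add: norm_block column_sum flip: sum_distrib_right)
  finally show ?thesis by (simp add: inner_mixing)
qed

text \<open>The weighted spread of u against itself is twice the inner product of u with u -
  \<open>mixing P u\<close>, hence zero here, and all its terms are nonnegative.\<close>

lemma mixing_fixed_consensus:
  assumes "mixing P u = u" "P $ i $ j > 0"
  shows "block u i = block u j"
proof -
  have "(\<Sum>i\<in>UNIV. \<Sum>j\<in>UNIV. P $ i $ j * (norm (block u i - block u j))\<^sup>2) = 0"
    using weighted_spread[of u u] assms(1) by (simp add: power2_norm_eq_inner)
  then have "\<forall>i\<in>UNIV. (\<Sum>j\<in>UNIV. P $ i $ j * (norm (block u i - block u j))\<^sup>2) = 0"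
    by (subst (asm) sum_nonneg_eq_0_iff) (auto intro!: sum_nonneg simp: entry_nonneg)
  then have "\<forall>j\<in>UNIV. P $ i $ j * (norm (block u i - block u j))\<^sup>2 = 0"
    by (subst (asm) sum_nonneg_eq_0_iff) (auto simp: entry_nonneg)
  then show ?thesis using assms(2) by (metis UNIV_I less_irrefl mult_eq_0_iff norm_eq_zero right_minus_eq zero_eq_power2)
qed

text \<open>Positivity holds coordinate by coordinate: for each k the entries u_(i,k), i ranging
  over the nodes, form a vector to which P applies. The upper bound by the identity is the
  nonnegativity of the weighted spread of u against itself.\<close>

lemma contraction_mixing:
  assumes psd: "pos_semidef P"
  shows "contraction (mixing P :: real^('v \<times> 'n::finite) \<Rightarrow> _)"
proof
  fix u v :: "real^('v \<times> 'n)" and c :: real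
  show "mixing P (u + v) = mixing P u + mixing P v"
    by (rule block_eqI) (simp add: block_mixing scaleR_add_right sum.distrib)
  show "mixing P (c *\<^sub>R u) = c *\<^sub>R mixing P u"
    by (rule block_eqI) (simp add: block_mixing scaleR_sum_right mult.commute)
  show "mixing P u \<bullet> v = u \<bullet> mixing P v"
    unfolding inner_mixing inner_commute[of "mixing P u"]
    by (subst sum.swap) (simp add: sym_entry inner_commute)
  have "u \<bullet> mixing P u = (\<Sum>k\<in>UNIV. (\<chi> i. u $ (i, k)) \<bullet> (P *v (\<chi> i. u $ (i, k))))"
  proof -
    have "u \<bullet> mixing P u = (\<Sum>i\<in>UNIV. \<Sum>k\<in>UNIV. u $ (i, k) * (\<Sum>j\<in>UNIV. P $ i $ j * u $ (j, k)))"
      unfolding inner_block[of u] by (simp add: inner_vec_def mixing_def unblock_def block_def)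
    also have "\<dots> = (\<Sum>k\<in>UNIV. \<Sum>i\<in>UNIV. u $ (i, k) * (\<Sum>j\<in>UNIV. P $ i $ j * u $ (j, k)))"
      by (rule sum.swap)
    finally show ?thesis by (simp add: inner_vec_def matrix_vector_mult_def)
  qed
  then show "0 \<le> u \<bullet> mixing P u"
    using psd by (auto simp: pos_semidef_def intro!: sum_nonneg)
  have "0 \<le> (\<Sum>i\<in>UNIV. \<Sum>j\<in>UNIV. P $ i $ j * (norm (block u i - block u j))\<^sup>2)"
    by (intro sum_nonneg) (auto simp: entry_nonneg)
  then show "u \<bullet> mixing P u \<le> u \<bullet> u"
    using weighted_spread[of u u] by (simp add: power2_norm_eq_inner)
qed

end

section \<open>One step of the algorithm\<close>

text \<open>The passage from extended real minimization to real inequalities. The witness u makes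
  the minimum finite, which forces G and \<Phi> to be finite at the minimizer; K collects the terms
  independent of the variable.\<close>

lemma is_prox_of_is_arg_min:
  assumes arg: "is_arg_min obj (\<lambda>z. z \<in> X) z"
    and fin: "\<And>u. u \<in> X \<Longrightarrow> \<bar>G u\<bar> \<noteq> \<infinity> \<Longrightarrow> \<bar>\<Phi> u\<bar> \<noteq> \<infinity> \<Longrightarrow>
      obj u = ereal (real_of_ereal (G u) + \<rho> * (real_of_ereal (\<Phi> u) - c \<bullet> u) + K)"
    and inf: "\<And>u. u \<in> X \<Longrightarrow> \<bar>G u\<bar> = \<infinity> \<or> \<bar>\<Phi> u\<bar> = \<infinity> \<Longrightarrow> obj u = \<infinity>"
    and u: "u \<in> X" "\<bar>G u\<bar> \<noteq> \<infinity>" "\<bar>\<Phi> u\<bar> \<noteq> \<infinity>"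
  shows "is_prox X G \<Phi> \<rho> c z"
proof -
  have z: "z \<in> X" and min: "\<And>v. v \<in> X \<Longrightarrow> obj z \<le> obj v"
    using arg by (auto simp: is_arg_min_linorder)
  have "obj z \<noteq> \<infinity>" using min[OF u(1)] fin[OF u] by auto
  then have zfin: "\<bar>G z\<bar> \<noteq> \<infinity>" "\<bar>\<Phi> z\<bar> \<noteq> \<infinity>" using inf[OF z] by auto
  show ?thesis
    unfolding is_prox_def
  proof (intro conjI z zfin ballI impI)
    fix v assume v: "v \<in> X" "\<bar>G v\<bar> \<noteq> \<infinity>" "\<bar>\<Phi> v\<bar> \<noteq> \<infinity>"
    show "real_of_ereal (G z) + \<rho> * (real_of_ereal (\<Phi> z) - c \<bullet> z)
        \<le> real_of_ereal (G v) + \<rho> * (real_of_ereal (\<Phi> v) - c \<bullet> v)"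
      using min[OF v(1)] fin[OF z zfin] fin[OF v] by simp
  qed
qed

lemma norm_scaled_sum:
  "(norm (a *\<^sub>R v + b *\<^sub>R w))\<^sup>2 = a\<^sup>2 * (norm v)\<^sup>2 + 2 * a * b * (v \<bullet> w) + b\<^sup>2 * (norm w)\<^sup>2"
  for v w :: "'a::real_inner"
  unfolding power2_norm_eq_inner
  by (simp add: inner_add_left inner_add_right inner_commute power2_eq_square algebra_simps)

lemma ext_convex_zero: "ext_convex (\<lambda>_. 0)"
  by (simp add: ext_convex_def)

text \<open>\<open>\<beta>\<close> is a strong convexity constant for the Euclidean norm, later
  \<alpha> * \<sigma>. \<open>finite_saddle\<close> is the part of V(0) < \<infinity> that concerns
  the saddle point.\<close>

locale bpdmm = mirror_space X D \<phi>
  for X D :: "(real^'n::finite) set" and \<phi> :: "real^'n \<Rightarrow> real" +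
  fixes E :: "('v::finite \<times> 'v) set" and P :: "real^'v^'v" and f :: "'v \<Rightarrow> real^'n \<Rightarrow> ereal"
    and \<beta> \<tau> \<rho> \<gamma> \<omega> :: real and xs \<mu>s :: "real^('v \<times> 'n)"
  assumes P_graph: "defined_on_graph P E"
    and closed_proper_convex_f: "closed_proper_convex (f i)"
    and saddle: "saddle_point f X P xs \<mu>s"
    and \<beta>_pos: "0 < \<beta>"
    and strong: "u \<in> X \<Longrightarrow> v \<in> X \<Longrightarrow> v \<in> D \<Longrightarrow>
      ereal (\<beta> / 2 * (norm (u - v))\<^sup>2) \<le> bregman D \<phi> u v"
    and sym: "transpose P = P" and stoch: "stochastic P" and psd: "pos_semidef P"
    and \<omega>: "0 < \<omega>" "\<omega> < 1" and \<tau>: "0 < \<tau>" and \<rho>: "0 < \<rho>" and \<gamma>: "0 < \<gamma>"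
    and step: "\<tau> * (2 - \<omega>) \<le> \<rho> * (\<omega> * \<beta> - \<gamma>)"
    and finite_saddle: "\<bar>closure_extension D \<phi> (block xs i)\<bar> \<noteq> \<infinity>"
begin

sublocale mix: contraction "mixing P :: real^('v \<times> 'n) \<Rightarrow> _"
  by (rule contraction_mixing[OF sym stoch psd])

lemmas P_nonneg = entry_nonneg[OF sym stoch]
lemmas P_row_sum = row_sum[OF sym stoch]

abbreviation Q :: "real^('v \<times> 'n) \<Rightarrow> real^('v \<times> 'n)" where
  "Q u \<equiv> disagreement P u"

lemma Q_simps:
  "Q (u + v) = Q u + Q v" "Q (u - v) = Q u - Q v" "Q (c *\<^sub>R u) = c *\<^sub>R Q u"
  by (auto simp: disagreement_eq mix.A_simps scaleR_diff_right)

lemma Q_self_adjoint: "Q u \<bullet> v = u \<bullet> Q v"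
  by (simp add: disagreement_eq inner_diff_left inner_diff_right mix.self_adjoint)

lemma block_Q: "block (Q u) i = block u i - (\<Sum>j\<in>UNIV. P $ i $ j *\<^sub>R block u j)"
  by (simp add: disagreement_eq block_mixing)

lemma neighbor_sum:
  fixes g :: "'v \<Rightarrow> 'b::comm_monoid_add"
  assumes "\<And>j. P $ i $ j = 0 \<Longrightarrow> g j = 0"
  shows "(\<Sum>j\<in>neighbors E i. g j) = (\<Sum>j\<in>UNIV. g j)"
proof (rule sum.mono_neutral_left)
  show "\<forall>j\<in>UNIV - neighbors E i. g j = 0"
  proof
    fix j assume "j \<in> UNIV - neighbors E i"
    then have "\<not> P $ i $ j > 0" using P_graph by (auto simp: defined_on_graph_def)
    then have "P $ i $ j = 0" using P_nonneg[of i j] by linarith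
    then show "g j = 0" by (rule assms)
  qed
qed auto

lemma saddle_consensus: "mixing P xs = xs"
  using saddle by (intro block_eqI) (auto simp: block_mixing saddle_point_def)

lemma Q_saddle: "Q xs = 0"
  by (simp add: disagreement_eq saddle_consensus)

lemma saddle_in_X: "block xs i \<in> X"
  using saddle by (auto simp: saddle_point_def)

lemma f_not_MInf: "f i u \<noteq> -\<infinity>"
  using closed_proper_convex_f[of i] by (auto simp: closed_proper_convex_def)

lemma saddle_subgradient:
  "- block (Q \<mu>s) i \<in> subdifferential (\<lambda>u. f i u + set_indicator X u) (block xs i)"
  using saddle by (auto simp: saddle_point_def block_Q)

lemma f_saddle_finite: "\<bar>f i (block xs i)\<bar> \<noteq> \<infinity>"
  using saddle_subgradient[of i] saddle_in_X[of i]
  by (auto simp: subdifferential_def set_indicator_def)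

lemma saddle_inequality:
  assumes "u \<in> X" "\<bar>f i u\<bar> \<noteq> \<infinity>"
  shows "real_of_ereal (f i (block xs i)) - block (Q \<mu>s) i \<bullet> (u - block xs i) \<le> real_of_ereal (f i u)"
proof -
  have "ereal (- block (Q \<mu>s) i \<bullet> (u - block xs i)) \<le> f i u - f i (block xs i)"
    using saddle_subgradient[of i] saddle_in_X[of i] assms(1)
    by (auto simp: subdifferential_def set_indicator_def dest: spec[of _ u])
  then show ?thesis
    using assms(2) f_saddle_finite[of i] by (cases "f i u"; cases "f i (block xs i)") auto
qed

lemma breg_ge:
  assumes "u \<in> X" "\<bar>\<Phi> u\<bar> \<noteq> \<infinity>" "v \<in> X" "v \<in> D"
  shows "\<beta> / 2 * (norm (u - v))\<^sup>2 \<le> breg u v"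
  using strong[OF assms(1,3,4)] by (simp add: bregman_eq_breg assms(2))

text \<open>The invariant of a run: membership in \<open>D\<close> gives access to the gradient at
  the blocks, finiteness of f makes the Lagrangian real.\<close>

definition feasible :: "real^('v \<times> 'n) \<Rightarrow> bool" where
  "feasible u \<longleftrightarrow> (\<forall>i. block u i \<in> X \<and> block u i \<in> D \<and> \<bar>f i (block u i)\<bar> \<noteq> \<infinity>)"

definition is_y_update :: "real^('v \<times> 'n) \<Rightarrow> 'v \<Rightarrow> real^'n \<Rightarrow> bool" where
  "is_y_update u i y \<longleftrightarrow> is_arg_min
     (\<lambda>z. \<Sum>j\<in>neighbors E i. ereal (P $ i $ j) * bregman D \<phi> z (block u j)) (\<lambda>z. z \<in> X) y"

definition is_x_update :: "real^('v \<times> 'n) \<Rightarrow> 'v \<Rightarrow> real^'n \<Rightarrow> real^'n \<Rightarrow> bool" where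
  "is_x_update m i y v \<longleftrightarrow> is_arg_min
     (\<lambda>z. f i z + ereal (z \<bullet> (block m i - (\<Sum>j\<in>neighbors E i. P $ i $ j *\<^sub>R block m j)))
          + ereal \<rho> * bregman D \<phi> z y) (\<lambda>z. z \<in> X) v"

definition mean_gradient :: "real^('v \<times> 'n) \<Rightarrow> 'v \<Rightarrow> real^'n" where
  "mean_gradient u i = (\<Sum>j\<in>UNIV. P $ i $ j *\<^sub>R gradient \<phi> (block u j))"

text \<open>Because the weights in row i sum to 1, the weighted sum of divergences from the
  neighbours is \<Phi> minus the linear form of the averaged gradient, up to the constant K.\<close>

lemma y_update_prox:
  assumes u: "feasible u" and y: "is_y_update u i y"
  shows "is_prox X (\<lambda>_. 0) \<Phi> 1 (mean_gradient u i) y"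
proof -
  define K where "K = (\<Sum>j\<in>UNIV. P $ i $ j * (gradient \<phi> (block u j) \<bullet> block u j - \<phi> (block u j)))"
  show ?thesis
  proof (rule is_prox_of_is_arg_min[OF y[unfolded is_y_update_def], where K=K and u="block u i"])
    show "block u i \<in> X" using u by (auto simp: feasible_def)
    show "\<bar>\<Phi> (block u i)\<bar> \<noteq> \<infinity>" using u by (auto simp: feasible_def closure_extension_eq)
  next
    fix z assume "\<bar>\<Phi> z\<bar> \<noteq> \<infinity>"
    then have "(\<Sum>j\<in>neighbors E i. ereal (P $ i $ j) * bregman D \<phi> z (block u j))
        = ereal (\<Sum>j\<in>UNIV. P $ i $ j * breg z (block u j))"
      by (subst neighbor_sum) (auto simp: bregman_eq_breg)
    also have "(\<Sum>j\<in>UNIV. P $ i $ j * breg z (block u j))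
        = (\<Sum>j\<in>UNIV. P $ i $ j) * real_of_ereal (\<Phi> z) - mean_gradient u i \<bullet> z + K"
      by (simp add: breg_def mean_gradient_def K_def inner_sum_left inner_diff_right sum_distrib_left
          algebra_simps sum.distrib sum_subtractf)
    finally show "(\<Sum>j\<in>neighbors E i. ereal (P $ i $ j) * bregman D \<phi> z (block u j))
        = ereal (real_of_ereal 0 + 1 * (real_of_ereal (\<Phi> z) - mean_gradient u i \<bullet> z) + K)"
      by (simp add: P_row_sum)
  next
    fix z assume "\<bar>0::ereal\<bar> = \<infinity> \<or> \<bar>\<Phi> z\<bar> = \<infinity>"
    moreover have "block u i \<in> D" using u by (auto simp: feasible_def)
    ultimately have inf: "\<Phi> z = \<infinity>" using closure_extension_not_MInf[of "block u i" z] by auto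
    \<comment> \<open>As 0 * \<infinity> = 0 in \<open>ereal\<close>, an index of positive weight is
      required for the sum to be infinite.\<close>
    obtain j where j: "P $ i $ j > 0"
    proof (rule ccontr)
      assume "\<not> thesis"
      then have "P $ i $ j = 0" for j using that[of j] P_nonneg[of i j] by fastforce
      then show False using P_row_sum[of i] by simp
    qed
    then have "j \<in> neighbors E i" using P_graph by (auto simp: defined_on_graph_def)
    then show "(\<Sum>j\<in>neighbors E i. ereal (P $ i $ j) * bregman D \<phi> z (block u j)) = \<infinity>"
      using j by (auto simp: sum_Pinfty bregman_eq_PInfty[OF inf] intro!: bexI[of _ j])
  qed simp
qed

lemma y_update_in:
  assumes u: "feasible u" and y: "is_y_update u i y"
  shows "y \<in> X" "y \<in> D"
proof -
  note prox = y_update_prox[OF u y]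
  show "y \<in> X" using prox by (auto simp: is_prox_def)
  show "y \<in> D"
    using u by (intro is_prox_in_D[OF prox ext_convex_zero, of "block u i"]) (auto simp: feasible_def)
qed

text \<open>The linear dual term is absorbed into the gradient at y, shifting it by -1/\<rho> times
  the block of \<open>Q m\<close>. The point v0, in applications the old block, witnesses a finite
  objective.\<close>

lemma x_update_prox:
  assumes v0: "v0 \<in> X" "v0 \<in> D" "\<bar>f i v0\<bar> \<noteq> \<infinity>" and y: "y \<in> D" and v: "is_x_update m i y v"
  shows "is_prox X (f i) \<Phi> \<rho> (gradient \<phi> y - (1 / \<rho>) *\<^sub>R block (Q m) i) v"
proof -
  have Qm: "block m i - (\<Sum>j\<in>neighbors E i. P $ i $ j *\<^sub>R block m j) = block (Q m) i"
    by (subst neighbor_sum) (auto simp: block_Q)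
  show ?thesis
  proof (rule is_prox_of_is_arg_min[OF v[unfolded is_x_update_def Qm],
      where K="\<rho> * (gradient \<phi> y \<bullet> y - \<phi> y)" and u=v0])
    fix z assume "\<bar>f i z\<bar> \<noteq> \<infinity>" "\<bar>\<Phi> z\<bar> \<noteq> \<infinity>"
    then show "f i z + ereal (z \<bullet> block (Q m) i) + ereal \<rho> * bregman D \<phi> z y
        = ereal (real_of_ereal (f i z)
            + \<rho> * (real_of_ereal (\<Phi> z) - (gradient \<phi> y - (1 / \<rho>) *\<^sub>R block (Q m) i) \<bullet> z)
            + \<rho> * (gradient \<phi> y \<bullet> y - \<phi> y))"
      using \<rho> by (cases "f i z")
        (auto simp: bregman_eq_breg breg_def inner_diff_left inner_diff_right inner_commute field_simps)
  next
    fix z assume inf: "\<bar>f i z\<bar> = \<infinity> \<or> \<bar>\<Phi> z\<bar> = \<infinity>"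
    have n: "f i z \<noteq> -\<infinity>" "\<Phi> z \<noteq> -\<infinity>"
      using f_not_MInf closure_extension_not_MInf[OF y] by auto
    show "f i z + ereal (z \<bullet> block (Q m) i) + ereal \<rho> * bregman D \<phi> z y = \<infinity>"
    proof (cases "\<Phi> z = \<infinity>")
      case True
      then show ?thesis using \<rho> n by (simp add: bregman_eq_PInfty)
    next
      case False
      then show ?thesis using inf n by (auto simp: bregman_eq_breg)
    qed
  qed (use v0 in \<open>auto simp: closure_extension_eq\<close>)
qed

lemma x_update_in:
  assumes v0: "v0 \<in> X" "v0 \<in> D" "\<bar>f i v0\<bar> \<noteq> \<infinity>" and y: "y \<in> D" and v: "is_x_update m i y v"
  shows "v \<in> X" "v \<in> D" "\<bar>f i v\<bar> \<noteq> \<infinity>"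
proof -
  note prox = x_update_prox[OF assms]
  show "v \<in> X" "\<bar>f i v\<bar> \<noteq> \<infinity>" using prox by (auto simp: is_prox_def)
  show "v \<in> D"
    by (rule is_prox_in_D[OF prox closed_proper_convex_ext_convex[OF closed_proper_convex_f] \<rho> v0])
qed

text \<open>Adding the variational inequalities of the two minimizers, each tested at the other,
  cancels G and leaves minus the symmetrized divergence, which strong convexity bounds by the
  squared distance.\<close>

lemma prox_unique:
  assumes G: "ext_convex G" and r: "0 < r"
    and z: "is_prox X G \<Phi> r c z" "z \<in> D" and z': "is_prox X G \<Phi> r c z'" "z' \<in> D"
  shows "z = z'"
proof -
  have X: "z \<in> X" "z' \<in> X" and Gf: "\<bar>G z\<bar> \<noteq> \<infinity>" "\<bar>G z'\<bar> \<noteq> \<infinity>"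
    using z z' by (auto simp: is_prox_def)
  have "0 \<le> r * ((gradient \<phi> z - c) \<bullet> (z' - z)) + r * ((gradient \<phi> z' - c) \<bullet> (z - z'))"
    using is_prox_variational[OF z(1) G z(2) X(2) Gf(2)]
      is_prox_variational[OF z'(1) G z'(2) X(1) Gf(1)] by linarith
  also have "\<dots> = - r * (breg z z' + breg z' z)"
    using z z' by (simp add: breg_def closure_extension_eq inner_diff_left inner_diff_right algebra_simps)
  finally have "breg z z' + breg z' z \<le> 0" using r by (simp add: mult_le_0_iff)
  moreover have "\<beta> / 2 * (norm (z - z'))\<^sup>2 \<le> breg z z'" "\<beta> / 2 * (norm (z' - z))\<^sup>2 \<le> breg z' z"
    using X z z' by (intro breg_ge; simp add: closure_extension_eq)+
  ultimately have "\<beta> * (norm (z - z'))\<^sup>2 \<le> 0" by (simp add: norm_minus_commute)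
  then show ?thesis using \<beta>_pos by (simp add: mult_le_0_iff)
qed

lemma y_update_unique:
  assumes "feasible u" "is_y_update u i y" "is_y_update u i y'"
  shows "y = y'"
  using assms by (intro prox_unique[OF ext_convex_zero _ y_update_prox _ y_update_prox] y_update_in) auto

lemma x_update_unique:
  assumes "v0 \<in> X" "v0 \<in> D" "\<bar>f i v0\<bar> \<noteq> \<infinity>" "y \<in> D" "is_x_update m i y v" "is_x_update m i y v'"
  shows "v = v'"
  using prox_unique[OF closed_proper_convex_ext_convex[OF closed_proper_convex_f] \<rho>
      x_update_prox[OF assms(1-5)] x_update_in(2)[OF assms(1-5)]
      x_update_prox[OF assms(1-4,6)] x_update_in(2)[OF assms(1-4,6)]] .

text \<open>The real value of L(u, \<open>\<mu>s\<close>) - L(\<open>xs\<close>,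
  \<open>\<mu>s\<close>); the second coupling term is absent because
  \<open>Q xs = 0\<close>.\<close>

definition gap :: "real^('v \<times> 'n) \<Rightarrow> real" where
  "gap u = (\<Sum>i\<in>UNIV. real_of_ereal (f i (block u i)) - real_of_ereal (f i (block xs i))) + \<mu>s \<bullet> Q u"

text \<open>The subgradient inequalities of the saddle point, summed over the nodes. Moving Q onto
  \<open>\<mu>s\<close> and using \<open>Q xs = 0\<close> turns the coupling term into their linear
  parts.\<close>

lemma gap_nonneg:
  assumes "\<And>i. block u i \<in> X" "\<And>i. \<bar>f i (block u i)\<bar> \<noteq> \<infinity>"
  shows "0 \<le> gap u"
proof -
  have "\<mu>s \<bullet> Q u = Q \<mu>s \<bullet> (u - xs)"
    by (simp add: Q_self_adjoint Q_simps Q_saddle)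
  then have "gap u = (\<Sum>i\<in>UNIV. real_of_ereal (f i (block u i)) - real_of_ereal (f i (block xs i))
      + block (Q \<mu>s) i \<bullet> (block u i - block xs i))"
    by (simp add: gap_def inner_block[of "Q \<mu>s"] sum.distrib)
  also have "\<dots> \<ge> 0"
    using saddle_inequality[OF assms] by (intro sum_nonneg) (auto simp: algebra_simps)
  finally show ?thesis .
qed

text \<open>Self-adjointness of Q turns the coupling of m with \<open>Q u\<close> into a sum over
  blocks of \<open>Q m\<close> against u, which is the linear term of the x update with dual
  variable m.\<close>

definition local_term :: "real^('v \<times> 'n) \<Rightarrow> 'v \<Rightarrow> real^'n \<Rightarrow> real" where
  "local_term m i v = real_of_ereal (f i v) - real_of_ereal (f i (block xs i))
     + block (Q m) i \<bullet> v + \<rho> * breg (block xs i) v"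

text \<open>The Lyapunov function, with \<open>\<mu>\<^sup>t - \<tau> Q x\<^sup>t\<close> rewritten as \<open>m = \<mu>\<^bsup>t-1\<^esup>\<close>; in this form it is
  separable in the blocks of \<open>x\<^sup>t\<close>, and its conditional expectation is easily computed.\<close>

definition lyap :: "real^('v \<times> 'n) \<Rightarrow> real^('v \<times> 'n) \<Rightarrow> real" where
  "lyap u m = (\<Sum>i\<in>UNIV. local_term m i (block u i)) + \<omega> / (2 * \<tau>) * (norm (\<mu>s - m))\<^sup>2"

lemma sum_local_term:
  "(\<Sum>i\<in>UNIV. local_term m i (block u i))
     = gap u + (m - \<mu>s) \<bullet> Q u + \<rho> * (\<Sum>i\<in>UNIV. breg (block xs i) (block u i))"
proof -
  have "(\<Sum>i\<in>UNIV. block (Q m) i \<bullet> block u i) = m \<bullet> Q u"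
    by (simp flip: inner_block add: Q_self_adjoint)
  then show ?thesis
    by (simp add: local_term_def gap_def sum.distrib sum_distrib_left inner_diff_left)
qed

text \<open>Only the inner product of m - \<open>\<mu>s\<close> with \<open>Q u\<close> can be
  negative. The square of \<omega> (m - \<open>\<mu>s\<close>) + \<tau> \<open>Q u\<close> bounds it
  below by the dual term and \<tau> / (2 \<omega>) times the squared norm of \<open>Q u\<close>,
  both with a minus sign. The divergences absorb the latter since
  \<open>norm (Q u) \<le> norm (xs - u)\<close> and \<tau> \<le> \<rho> \<omega> \<beta>, which
  follows from \<open>step\<close> as 2 - \<omega> \<ge> 1.\<close>

lemma lyap_nonneg:
  assumes u: "feasible u"
  shows "0 \<le> lyap u m"
proof -
  have breg: "\<beta> / 2 * (norm (xs - u))\<^sup>2 \<le> (\<Sum>i\<in>UNIV. breg (block xs i) (block u i))"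
    unfolding norm_block sum_distrib_left block_linear
    using u saddle_in_X finite_saddle by (intro sum_mono breg_ge) (auto simp: feasible_def)
  have "norm (Q u) \<le> norm (xs - u)"
    using mix.norm_complement_le[of "u - xs"]
    by (simp add: Q_simps Q_saddle norm_minus_commute flip: disagreement_eq)
  then have Qu: "(norm (Q u))\<^sup>2 \<le> (norm (xs - u))\<^sup>2" by (simp add: power_mono)
  have "\<tau> * 1 \<le> \<tau> * (2 - \<omega>)" using \<tau> \<omega> by (intro mult_left_mono) auto
  then have small: "\<tau> \<le> \<rho> * \<omega> * \<beta>"
    using step mult_pos_pos[OF \<rho> \<gamma>] by (simp add: algebra_simps)
  have "0 \<le> (norm (\<omega> *\<^sub>R (m - \<mu>s) + \<tau> *\<^sub>R Q u))\<^sup>2" by simp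
  also have "\<dots> = \<omega>\<^sup>2 * (norm (\<mu>s - m))\<^sup>2 + 2 * \<omega> * \<tau> * ((m - \<mu>s) \<bullet> Q u) + \<tau>\<^sup>2 * (norm (Q u))\<^sup>2"
    using norm_scaled_sum[of \<omega> "m - \<mu>s" \<tau> "Q u"] by (simp add: norm_minus_commute)
  also have "\<tau>\<^sup>2 * (norm (Q u))\<^sup>2 \<le> \<tau> * (\<rho> * \<omega> * \<beta>) * (norm (xs - u))\<^sup>2"
    unfolding power2_eq_square[of \<tau>] using small \<tau> Qu by (intro mult_mono mult_left_mono) auto
  also have "\<dots> = 2 * \<omega> * \<tau> * (\<rho> * (\<beta> / 2 * (norm (xs - u))\<^sup>2))" by simp
  also have "\<dots> \<le> 2 * \<omega> * \<tau> * (\<rho> * (\<Sum>i\<in>UNIV. breg (block xs i) (block u i)))"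
    using breg \<omega> \<tau> \<rho> by (intro mult_left_mono) auto
  finally have "0 \<le> \<omega>\<^sup>2 * (norm (\<mu>s - m))\<^sup>2 + 2 * \<omega> * \<tau> * ((m - \<mu>s) \<bullet> Q u)
      + 2 * \<omega> * \<tau> * (\<rho> * (\<Sum>i\<in>UNIV. breg (block xs i) (block u i)))"
    by simp
  moreover have "\<omega>\<^sup>2 * (norm (\<mu>s - m))\<^sup>2 = 2 * \<omega> * \<tau> * (\<omega> / (2 * \<tau>) * (norm (\<mu>s - m))\<^sup>2)"
    using \<tau> by (simp add: power2_eq_square)
  ultimately have "2 * \<omega> * \<tau> * 0 \<le> 2 * \<omega> * \<tau> * (\<omega> / (2 * \<tau>) * (norm (\<mu>s - m))\<^sup>2 + (m - \<mu>s) \<bullet> Q u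
      + \<rho> * (\<Sum>i\<in>UNIV. breg (block xs i) (block u i)))"
    by (simp only: distrib_left mult_zero_right)
  moreover have "0 < 2 * \<omega> * \<tau>" using \<omega> \<tau> by simp
  ultimately have "0 \<le> \<omega> / (2 * \<tau>) * (norm (\<mu>s - m))\<^sup>2 + (m - \<mu>s) \<bullet> Q u
      + \<rho> * (\<Sum>i\<in>UNIV. breg (block xs i) (block u i))"
    by (simp only: mult_le_cancel_left_pos)
  moreover have "0 \<le> gap u" using u by (intro gap_nonneg) (auto simp: feasible_def)
  ultimately show ?thesis unfolding lyap_def sum_local_term by linarith
qed

section \<open>A simultaneous update of all nodes\<close>

context
  fixes u m :: "real^('v \<times> 'n)" and y v :: "'v \<Rightarrow> real^'n"
  assumes u: "feasible u" and y: "\<And>i. is_y_update u i (y i)" and v: "\<And>i. is_x_update m i (y i) (v i)"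
begin

lemma y_in: "y i \<in> X" "y i \<in> D"
  using y_update_in[OF u y] by auto

lemma u_in: "block u i \<in> X" "block u i \<in> D" "\<bar>f i (block u i)\<bar> \<noteq> \<infinity>"
  using u by (auto simp: feasible_def)

text \<open>The variational inequality of each \<open>y i\<close> is tested at the saddle point, and
  the three-point identity is averaged over the neighbours. Strong convexity turns the divergences
  from \<open>block u j\<close> to \<open>y i\<close> into the weighted spread, which dominates the
  squared disagreement.\<close>

lemma mirror_step_bound:
  "(\<Sum>i\<in>UNIV. breg (block xs i) (y i))
     \<le> (\<Sum>i\<in>UNIV. breg (block xs i) (block u i)) - \<beta> / 2 * (norm (Q u))\<^sup>2"
proof -
  have each: "breg (block xs i) (y i)
      \<le> (\<Sum>j\<in>UNIV. P $ i $ j * breg (block xs i) (block u j)) - \<beta> / 2 * (\<Sum>j\<in>UNIV. P $ i $ j * (norm (y i - block u j))\<^sup>2)"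
    for i
  proof -
    have "0 \<le> (gradient \<phi> (y i) - mean_gradient u i) \<bullet> (block xs i - y i)"
      using is_prox_variational[OF y_update_prox[OF u y] ext_convex_zero y_in(2) saddle_in_X] by simp
    also have "gradient \<phi> (y i) - mean_gradient u i
        = (\<Sum>j\<in>UNIV. P $ i $ j *\<^sub>R (gradient \<phi> (y i) - gradient \<phi> (block u j)))"
      by (simp add: mean_gradient_def scaleR_diff_right sum_subtractf P_row_sum flip: scaleR_sum_left)
    also have "\<dots> \<bullet> (block xs i - y i)
        = (\<Sum>j\<in>UNIV. P $ i $ j * (breg (block xs i) (block u j) - breg (block xs i) (y i) - breg (y i) (block u j)))"
      by (simp add: inner_sum_left three_point[OF y_in(2)])
    also have "\<dots> \<le> (\<Sum>j\<in>UNIV. P $ i $ j * (breg (block xs i) (block u j) - breg (block xs i) (y i)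
        - \<beta> / 2 * (norm (y i - block u j))\<^sup>2))"
      using y_in u_in P_nonneg
      by (intro sum_mono mult_left_mono diff_left_mono breg_ge) (auto simp: closure_extension_eq)
    also have "\<dots> = (\<Sum>j\<in>UNIV. P $ i $ j * breg (block xs i) (block u j))
        - (\<Sum>j\<in>UNIV. P $ i $ j) * breg (block xs i) (y i)
        - \<beta> / 2 * (\<Sum>j\<in>UNIV. P $ i $ j * (norm (y i - block u j))\<^sup>2)"
      by (simp add: right_diff_distrib sum_subtractf sum_distrib_left sum_distrib_right mult_ac)
    finally show ?thesis by (simp add: P_row_sum)
  qed
  \<comment> \<open>Consensus of \<open>xs\<close> across positive weights replaces
    \<open>block xs i\<close> by \<open>block xs j\<close>; the column sums of P then collapse the
    double sum.\<close>
  have "(\<Sum>i\<in>UNIV. \<Sum>j\<in>UNIV. P $ i $ j * breg (block xs i) (block u j))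
      = (\<Sum>i\<in>UNIV. \<Sum>j\<in>UNIV. P $ i $ j * breg (block xs j) (block u j))"
  proof (intro sum.cong refl)
    fix i j
    show "P $ i $ j * breg (block xs i) (block u j) = P $ i $ j * breg (block xs j) (block u j)"
      using mixing_fixed_consensus[OF sym stoch saddle_consensus, of i j] P_nonneg[of i j]
      by (cases "P $ i $ j = 0") auto
  qed
  also have "\<dots> = (\<Sum>j\<in>UNIV. (\<Sum>i\<in>UNIV. P $ i $ j) * breg (block xs j) (block u j))"
    by (subst sum.swap) (simp add: sum_distrib_right)
  finally have cons: "(\<Sum>i\<in>UNIV. \<Sum>j\<in>UNIV. P $ i $ j * breg (block xs i) (block u j))
      = (\<Sum>j\<in>UNIV. breg (block xs j) (block u j))"
    by (simp add: column_sum[OF sym stoch])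
  have "(norm (Q u))\<^sup>2 \<le> (\<Sum>i\<in>UNIV. \<Sum>j\<in>UNIV. P $ i $ j * (norm (y i - block u j))\<^sup>2)"
    using mix.complement_le_spread[of u "unblock y"] weighted_spread[OF sym stoch, of "unblock y" u]
    by (simp add: disagreement_eq)
  then have "\<beta> / 2 * (norm (Q u))\<^sup>2 \<le> \<beta> / 2 * (\<Sum>i\<in>UNIV. \<Sum>j\<in>UNIV. P $ i $ j * (norm (y i - block u j))\<^sup>2)"
    using \<beta>_pos by (intro mult_left_mono) auto
  moreover have "(\<Sum>i\<in>UNIV. breg (block xs i) (y i))
      \<le> (\<Sum>i\<in>UNIV. (\<Sum>j\<in>UNIV. P $ i $ j * breg (block xs i) (block u j)) - \<beta> / 2 * (\<Sum>j\<in>UNIV. P $ i $ j * (norm (y i - block u j))\<^sup>2))"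
    by (intro sum_mono each)
  ultimately show ?thesis unfolding sum_subtractf cons sum_distrib_left[symmetric] by linarith
qed

text \<open>The x update is tested at the saddle point. The divergence between \<open>v i\<close>
  and \<open>y i\<close> is dropped as nonnegative, and the blocks of \<open>Q m\<close> against
  \<open>xs\<close> sum to zero because \<open>Q xs = 0\<close>.\<close>

lemma full_step_bound:
  "(\<Sum>i\<in>UNIV. local_term m i (v i))
     \<le> \<rho> * ((\<Sum>i\<in>UNIV. breg (block xs i) (block u i)) - \<beta> / 2 * (norm (Q u))\<^sup>2)"
proof -
  have each: "local_term m i (v i) \<le> block (Q m) i \<bullet> block xs i + \<rho> * breg (block xs i) (y i)" for i
  proof -
    note v' = x_update_in[OF u_in(1)[of i] u_in(2,3) y_in(2) v] x_update_prox[OF u_in(1)[of i] u_in(2,3) y_in(2) v]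
    let ?g = "\<lambda>z. gradient \<phi> z" and ?q = "block (Q m) i" and ?x = "block xs i"
    have "0 \<le> real_of_ereal (f i ?x) - real_of_ereal (f i (v i))
        + \<rho> * ((?g (v i) - (?g (y i) - (1 / \<rho>) *\<^sub>R ?q)) \<bullet> (?x - v i))"
      by (rule is_prox_variational[OF v'(4) closed_proper_convex_ext_convex[OF closed_proper_convex_f]
            v'(2) saddle_in_X f_saddle_finite])
    also have "(?g (v i) - (?g (y i) - (1 / \<rho>) *\<^sub>R ?q)) \<bullet> (?x - v i)
        = (?g (v i) - ?g (y i)) \<bullet> (?x - v i) + 1 / \<rho> * (?q \<bullet> (?x - v i))"
      by (simp add: inner_diff_left)
    also have "(?g (v i) - ?g (y i)) \<bullet> (?x - v i) = breg ?x (y i) - breg ?x (v i) - breg (v i) (y i)"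
      by (rule three_point[OF v'(2)])
    finally have "0 \<le> real_of_ereal (f i ?x) - real_of_ereal (f i (v i))
        + \<rho> * (breg ?x (y i) - breg ?x (v i) - breg (v i) (y i)) + ?q \<bullet> (?x - v i)"
      using \<rho> by (simp add: distrib_left)
    moreover have "0 \<le> \<rho> * breg (v i) (y i)"
    proof -
      have "0 \<le> \<beta> / 2 * (norm (v i - y i))\<^sup>2" using \<beta>_pos by simp
      also have "\<dots> \<le> breg (v i) (y i)"
        using v' y_in by (intro breg_ge) (auto simp: closure_extension_eq)
      finally show ?thesis using \<rho> by simp
    qed
    ultimately show ?thesis by (simp add: local_term_def inner_diff_right algebra_simps)
  qed
  have "(\<Sum>i\<in>UNIV. block (Q m) i \<bullet> block xs i) = 0"
    by (simp flip: inner_block add: Q_self_adjoint Q_saddle)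
  moreover have "(\<Sum>i\<in>UNIV. local_term m i (v i))
      \<le> (\<Sum>i\<in>UNIV. block (Q m) i \<bullet> block xs i + \<rho> * breg (block xs i) (y i))"
    by (intro sum_mono each)
  ultimately have "(\<Sum>i\<in>UNIV. local_term m i (v i)) \<le> \<rho> * (\<Sum>i\<in>UNIV. breg (block xs i) (y i))"
    by (simp add: sum.distrib flip: sum_distrib_left)
  also have "\<dots> \<le> \<rho> * ((\<Sum>i\<in>UNIV. breg (block xs i) (block u i)) - \<beta> / 2 * (norm (Q u))\<^sup>2)"
    using mirror_step_bound \<rho> by (intro mult_left_mono) auto
  finally show ?thesis .
qed

end

text \<open>The left side will be the mean of the next Lyapunov value. The weight \<omega> / (2
  \<tau>) in V makes the multiples of \<open>s\<close> cancel; those of \<open>B\<close> and of the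
  gap cancel too. By \<open>full_step_bound\<close>, right minus left is at least \<open>(\<rho> *
  (\<omega> * \<beta> - \<gamma>) - \<tau> * (2 - \<omega>)) * r / 2\<close>: this is where the step
  size condition comes from.\<close>

lemma descent:
  assumes u: "feasible u" and y: "\<And>i. is_y_update u i (y i)" and v: "\<And>i. is_x_update m i (y i) (v i)"
    and m: "m = m' + \<tau> *\<^sub>R Q u"
  shows "\<omega> * (\<Sum>i\<in>UNIV. local_term m i (v i)) + (1 - \<omega>) * (\<Sum>i\<in>UNIV. local_term m i (block u i))
      + \<omega> / (2 * \<tau>) * (norm (\<mu>s - m))\<^sup>2
    \<le> lyap u m' - \<omega> * gap u - \<gamma> * \<rho> / 2 * (norm (Q u))\<^sup>2"
proof -
  define B where "B = (\<Sum>i\<in>UNIV. breg (block xs i) (block u i))"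
  define r where "r = (norm (Q u))\<^sup>2"
  define s where "s = (\<mu>s - m) \<bullet> Q u"
  have "\<omega> * (\<Sum>i\<in>UNIV. local_term m i (v i)) \<le> \<omega> * (\<rho> * (B - \<beta> / 2 * r))"
    unfolding B_def r_def using full_step_bound[OF u y v] \<omega> by (intro mult_left_mono) auto
  moreover have "(1 - \<omega>) * (\<Sum>i\<in>UNIV. local_term m i (block u i)) = (1 - \<omega>) * (gap u - s + \<rho> * B)"
    by (simp add: sum_local_term B_def s_def inner_diff_left)
  moreover have "(m' - \<mu>s) \<bullet> Q u = - s - \<tau> * r"
    by (simp add: m s_def r_def inner_diff_left inner_add_left power2_norm_eq_inner)
  then have "(\<Sum>i\<in>UNIV. local_term m' i (block u i)) = gap u - s - \<tau> * r + \<rho> * B"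
    by (simp add: sum_local_term B_def)
  moreover have "\<omega> / (2 * \<tau>) * (norm (\<mu>s - m'))\<^sup>2
      = \<omega> / (2 * \<tau>) * (norm (\<mu>s - m))\<^sup>2 + \<omega> * s + \<omega> * \<tau> / 2 * r"
  proof -
    have eq: "\<mu>s - m' = (\<mu>s - m) + \<tau> *\<^sub>R Q u" by (simp add: m)
    have "(norm (\<mu>s - m'))\<^sup>2 = (norm (\<mu>s - m))\<^sup>2 + 2 * \<tau> * s + \<tau>\<^sup>2 * r"
      unfolding eq s_def r_def using norm_scaled_sum[of 1 "\<mu>s - m" \<tau> "Q u"] by simp
    then show ?thesis using \<tau> by (simp add: field_simps power2_eq_square)
  qed
  moreover have "\<tau> * (2 - \<omega>) * r \<le> \<rho> * (\<omega> * \<beta> - \<gamma>) * r"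
    using step by (intro mult_right_mono) (auto simp: r_def)
  ultimately show ?thesis unfolding lyap_def r_def[symmetric] by argo
qed

end

section \<open>Random node sets\<close>

text \<open>Removing i is a bijection onto the (k-1)-subsets of the other nodes, so this is the
  absorption identity for binomial coefficients.\<close>

lemma card_sets_containing:
  fixes i :: "'v::finite"
  assumes "0 < k"
  shows "CARD('v) * card {A. card A = k \<and> i \<in> A} = k * card {A :: 'v set. card A = k}"
proof -
  have "{A. card A = k \<and> i \<in> A} = insert i ` {B. B \<subseteq> UNIV - {i} \<and> card B = k - 1}"
  proof (intro equalityI subsetI)
    fix A assume "A \<in> {A. card A = k \<and> i \<in> A}"
    then show "A \<in> insert i ` {B. B \<subseteq> UNIV - {i} \<and> card B = k - 1}"
      by (intro image_eqI[of _ _ "A - {i}"]) auto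
  next
    fix A assume "A \<in> insert i ` {B. B \<subseteq> UNIV - {i} \<and> card B = k - 1}"
    then show "A \<in> {A. card A = k \<and> i \<in> A}"
      using assms by (auto simp: card_insert_if)
  qed
  moreover have "inj_on (insert i) {B. B \<subseteq> UNIV - {i} \<and> card B = k - 1}"
    by (auto simp: inj_on_def)
  ultimately have "card {A. card A = k \<and> i \<in> A} = (CARD('v) - 1) choose (k - 1)"
    using n_subsets[of "UNIV - {i}" "k - 1"] by (simp add: card_image)
  moreover have "card {A :: 'v set. card A = k} = CARD('v) choose k"
    using n_subsets[of "UNIV :: 'v set" k] by simp
  ultimately show ?thesis
    using times_binomial_minus1_eq[OF assms, of "CARD('v)"] by simp
qed

definition node_sets :: "real \<Rightarrow> 'v::finite set set" where
  "node_sets \<omega> = {A. real (card A) / real CARD('v) = \<omega>}"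

text \<open>A uniformly drawn set contains a given node with probability \<omega>. Nonemptiness
  provides an integer size equal to \<omega> times the number of nodes.\<close>

lemma card_node_sets_containing:
  fixes i :: "'v::finite"
  assumes "0 < \<omega>" "node_sets \<omega> \<noteq> ({} :: 'v set set)"
  shows "real (card {A \<in> node_sets \<omega>. i \<in> A}) = \<omega> * real (card (node_sets \<omega> :: 'v set set))"
proof -
  obtain A0 :: "'v set" where A0: "real (card A0) / real CARD('v) = \<omega>"
    using assms(2) by (auto simp: node_sets_def)
  have n: "0 < real CARD('v)" by simp
  have eq: "node_sets \<omega> = {A :: 'v set. card A = card A0}"
    unfolding node_sets_def using A0 n by (auto simp: field_simps)
  have "0 < card A0" using A0 assms(1) by (metis div_0 gr0I less_irrefl of_nat_0)
  from card_sets_containing[OF this, of i]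
  have "real CARD('v) * real (card {A \<in> node_sets \<omega>. i \<in> A})
      = real (card A0) * real (card (node_sets \<omega> :: 'v set set))"
    unfolding eq by (simp flip: of_nat_mult)
  moreover have "real (card A0) = \<omega> * real CARD('v)" using A0 n by (simp add: field_simps)
  ultimately show ?thesis using n by simp
qed

locale node_sampling = prob_space M for M :: "'w measure" +
  fixes \<omega> :: real and S :: "nat \<Rightarrow> 'w \<Rightarrow> 'v::finite set"
  assumes random: "random_node_sets M \<omega> S"
begin

abbreviation \<A> :: "'v set set" where "\<A> \<equiv> node_sets \<omega>"

lemma S_in: "w \<in> space M \<Longrightarrow> 1 \<le> t \<Longrightarrow> S t w \<in> \<A>"
  using random by (auto simp: random_node_sets_def node_sets_def)

lemma node_sets_nonempty: "\<A> \<noteq> {}"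
  using S_in[of _ 1] not_empty by blast

lemma indep: "indep_vars (\<lambda>_. count_space UNIV) S {1..}"
  using random by (auto simp: random_node_sets_def)

lemma S_measurable: "1 \<le> t \<Longrightarrow> S t \<in> measurable M (count_space UNIV)"
  using indep by (auto simp: indep_vars_def)

lemma prob_S_eq:
  assumes "1 \<le> t" "A \<in> \<A>"
  shows "prob (S t -` {A} \<inter> space M) = 1 / card \<A>"
proof -
  have "prob (S t -` {A} \<inter> space M) = measure (distr M (count_space UNIV) (S t)) {A}"
    using S_measurable[OF assms(1)] by (simp add: measure_distr)
  also have "distr M (count_space UNIV) (S t) = measure_pmf (pmf_of_set \<A>)"
    using random assms(1) by (simp add: random_node_sets_def node_sets_def)
  also have "measure (measure_pmf (pmf_of_set \<A>)) {A} = 1 / card \<A>"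
    using assms(2) node_sets_nonempty by (simp add: measure_pmf_single pmf_of_set)
  finally show ?thesis .
qed

text \<open>A list starting at index 1, as \<open>S 0\<close> is not a draw; one more draw is
  appended at the end.\<close>

definition history :: "nat \<Rightarrow> 'w \<Rightarrow> 'v set list" where
  "history t w = map (\<lambda>k. S k w) [1..<Suc t]"

definition histories :: "nat \<Rightarrow> 'v set list set" where
  "histories t = {h. set h \<subseteq> \<A> \<and> length h = t}"

lemma finite_histories: "finite (histories t)"
  unfolding histories_def by (rule finite_lists_length_eq) simp

lemma history_Suc: "history (Suc t) w = history t w @ [S (Suc t) w]"
  by (simp add: history_def)

lemma history_in: "w \<in> space M \<Longrightarrow> history t w \<in> histories t"
  by (auto simp: history_def histories_def intro: S_in)

lemma history_eq_iff:
  "length h = t \<Longrightarrow> history t w = h \<longleftrightarrow> (\<forall>k\<in>{1..t}. S k w = h ! (k - 1))"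
proof -
  assume len: "length h = t"
  have "(\<forall>k\<in>{1..t}. S k w = h ! (k - 1)) \<longleftrightarrow> (\<forall>k<t. S (Suc k) w = h ! k)"
  proof (intro iffI ballI allI impI)
    fix k assume "\<forall>k<t. S (Suc k) w = h ! k" "k \<in> {1..t}"
    then show "S k w = h ! (k - 1)" by (cases k) auto
  next
    fix k assume *: "\<forall>k\<in>{1..t}. S k w = h ! (k - 1)" and "k < t"
    then have "Suc k \<in> {1..t}" by simp
    from bspec[OF * this] show "S (Suc k) w = h ! k" by simp
  qed
  moreover have "history t w = h \<longleftrightarrow> (\<forall>k<t. S (Suc k) w = h ! k)"
    using len by (simp add: list_eq_iff_nth_eq history_def del: upt_Suc)
  ultimately show ?thesis by blast
qed

lemma prob_history:
  assumes h: "h \<in> histories t"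
  shows "{w \<in> space M. history t w = h} \<in> events"
    and "prob {w \<in> space M. history t w = h} = (1 / card \<A>) ^ t"
proof -
  have len: "length h = t" and nth: "\<And>k. k \<in> {1..t} \<Longrightarrow> h ! (k - 1) \<in> \<A>"
    using h by (auto simp: histories_def)
  have "{w \<in> space M. history t w = h} \<in> events \<and>
      prob {w \<in> space M. history t w = h} = (1 / card \<A>) ^ t"
  \<comment> \<open>For t = 0 the intersection used below would be the whole type instead of
    \<open>space M\<close>.\<close>
  proof (cases "t = 0")
    case True
    then show ?thesis using len by (simp add: history_def prob_space)
  next
    case False
    have eq: "{w \<in> space M. history t w = h} = (\<Inter>k\<in>{1..t}. S k -` {h ! (k - 1)} \<inter> space M)"
      using False by (auto simp: history_eq_iff[OF len])
    have "(\<Inter>k\<in>{1..t}. S k -` {h ! (k - 1)} \<inter> space M) \<in> events"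
      using False by (intro sets.finite_INT measurable_sets[OF S_measurable]) auto
    moreover have "prob (\<Inter>k\<in>{1..t}. S k -` {h ! (k - 1)} \<inter> space M)
        = (\<Prod>k\<in>{1..t}. prob (S k -` {h ! (k - 1)} \<inter> space M))"
      using False by (intro indep_varsD[OF indep]) auto
    moreover have "\<dots> = (\<Prod>k\<in>{1..t}. 1 / card \<A>)"
      using nth by (intro prod.cong refl prob_S_eq) auto
    ultimately show ?thesis unfolding eq by simp
  qed
  then show "{w \<in> space M. history t w = h} \<in> events"
    and "prob {w \<in> space M. history t w = h} = (1 / card \<A>) ^ t" by auto
qed

text \<open>A history has positive probability, hence is attained. This supplies actual runs for
  every continuation of a given past.\<close>

lemma history_surj:
  assumes "h \<in> histories t"
  obtains w where "w \<in> space M" "history t w = h"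
proof -
  have "prob {w \<in> space M. history t w = h} > 0"
    using prob_history(2)[OF assms] node_sets_nonempty by (simp add: card_gt_0_iff)
  then have "{w \<in> space M. history t w = h} \<noteq> {}" by (metis less_irrefl measure_empty)
  then show thesis using that by blast
qed

text \<open>Adaptedness to the filtration of the draws, stated as functional dependence. Histories
  take finitely many values, so this yields measurability of Z instead of presupposing it.\<close>

definition adapted :: "nat \<Rightarrow> ('w \<Rightarrow> 'a) \<Rightarrow> bool" where
  "adapted t Z \<longleftrightarrow>
     (\<forall>w\<in>space M. \<forall>w'\<in>space M. history t w = history t w' \<longrightarrow> Z w = Z w')"

definition at_history :: "nat \<Rightarrow> ('w \<Rightarrow> 'a) \<Rightarrow> 'v set list \<Rightarrow> 'a" where
  "at_history t Z h = Z (SOME w. w \<in> space M \<and> history t w = h)"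

lemma at_history:
  assumes "adapted t Z" "w \<in> space M"
  shows "at_history t Z (history t w) = Z w"
proof -
  have "(SOME w'. w' \<in> space M \<and> history t w' = history t w) \<in> space M \<and>
      history t (SOME w'. w' \<in> space M \<and> history t w' = history t w) = history t w"
    by (rule someI[of _ w]) (use assms(2) in simp)
  then show ?thesis
    using assms unfolding at_history_def adapted_def by blast
qed

text \<open>On \<open>space M\<close>, Z is a finite combination of indicators of the history
  events, which are all equally likely.\<close>

lemma adapted_expectation:
  fixes Z :: "'w \<Rightarrow> real"
  assumes Z: "adapted t Z"
  shows "integrable M Z"
    and "expectation Z = (1 / card \<A>) ^ t * (\<Sum>h\<in>histories t. at_history t Z h)"
proof -
  let ?g = "\<lambda>w. \<Sum>h\<in>histories t. at_history t Z h * indicator {w \<in> space M. history t w = h} w"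
  have eq: "Z w = ?g w" if w: "w \<in> space M" for w
  proof -
    have "?g w = (\<Sum>h\<in>histories t. if h = history t w then at_history t Z h else 0)"
      using w by (intro sum.cong) auto
    also have "\<dots> = Z w"
      using history_in[OF w] finite_histories at_history[OF Z w] by simp
    finally show ?thesis by simp
  qed
  have int: "integrable M (\<lambda>w. at_history t Z h * indicator {w \<in> space M. history t w = h} w)"
    if "h \<in> histories t" for h
    using prob_history(1)[OF that]
    by (intro integrable_mult_right integrable_real_indicator) (auto simp: emeasure_eq_measure)
  show "integrable M Z"
    using int by (subst Bochner_Integration.integrable_cong[OF refl eq]) auto
  have "expectation Z = expectation ?g"
    by (intro Bochner_Integration.integral_cong refl eq)
  also have "\<dots> = (\<Sum>h\<in>histories t. expectation (\<lambda>w. at_history t Z h * indicator {w \<in> space M. history t w = h} w))"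
    using int by (rule Bochner_Integration.integral_sum)
  also have "\<dots> = (\<Sum>h\<in>histories t. at_history t Z h * (1 / card \<A>) ^ t)"
  proof (intro sum.cong refl)
    fix h assume h: "h \<in> histories t"
    have "{w \<in> space M. history t w = h} \<inter> space M = {w \<in> space M. history t w = h}" by auto
    then show "expectation (\<lambda>w. at_history t Z h * indicator {w \<in> space M. history t w = h} w)
        = at_history t Z h * (1 / card \<A>) ^ t"
      using prob_history[OF h] by simp
  qed
  finally show "expectation Z = (1 / card \<A>) ^ t * (\<Sum>h\<in>histories t. at_history t Z h)"
    by (simp add: sum_distrib_left mult.commute)
qed

lemma histories_Suc: "histories (Suc t) = (\<lambda>(h, A). h @ [A]) ` (histories t \<times> \<A>)"
proof (intro equalityI subsetI)
  fix h assume "h \<in> histories (Suc t)"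
  then show "h \<in> (\<lambda>(h, A). h @ [A]) ` (histories t \<times> \<A>)"
    by (cases h rule: rev_cases) (auto simp: histories_def image_iff)
qed (auto simp: histories_def)

text \<open>The tower property in finite form: histories of length t + 1 are grouped by their first
  t draws. \<open>W A\<close> is a sample point that repeats the past of w and then draws A.\<close>

lemma expectation_step_le:
  fixes Z Z' :: "'w \<Rightarrow> real"
  assumes Z: "adapted t Z" and Z': "adapted (Suc t) Z'"
    and step: "\<And>w W. w \<in> space M \<Longrightarrow> (\<And>A. A \<in> \<A> \<Longrightarrow> W A \<in> space M) \<Longrightarrow>
      (\<And>A. A \<in> \<A> \<Longrightarrow> history (Suc t) (W A) = history t w @ [A]) \<Longrightarrow>
      (\<Sum>A\<in>\<A>. Z' (W A)) \<le> card \<A> * Z w"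
  shows "expectation Z' \<le> expectation Z"
proof -
  let ?N = "real (card \<A>)"
  have N: "0 < ?N" using node_sets_nonempty by (simp add: card_gt_0_iff)
  have le: "(\<Sum>A\<in>\<A>. at_history (Suc t) Z' (h @ [A])) \<le> ?N * at_history t Z h"
    if h: "h \<in> histories t" for h
  proof -
    obtain w where w: "w \<in> space M" "history t w = h" using history_surj[OF h] .
    have "\<exists>w'. w' \<in> space M \<and> history (Suc t) w' = h @ [A]" if "A \<in> \<A>" for A
      using history_surj[of "h @ [A]" "Suc t"] h that by (auto simp: histories_def)
    then obtain W where W: "\<And>A. A \<in> \<A> \<Longrightarrow> W A \<in> space M \<and> history (Suc t) (W A) = h @ [A]"
      by metis
    have "(\<Sum>A\<in>\<A>. at_history (Suc t) Z' (h @ [A])) = (\<Sum>A\<in>\<A>. Z' (W A))"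
      using W at_history[OF Z'] by (intro sum.cong) metis+
    also have "\<dots> \<le> ?N * Z w" using W w by (intro step) auto
    also have "Z w = at_history t Z h" using at_history[OF Z w(1)] w(2) by simp
    finally show ?thesis .
  qed
  have inj: "inj_on (\<lambda>(h, A). h @ [A]) (histories t \<times> \<A>)" by (auto simp: inj_on_def)
  have "expectation Z' = (1 / ?N) ^ Suc t * (\<Sum>h\<in>histories t. \<Sum>A\<in>\<A>. at_history (Suc t) Z' (h @ [A]))"
    unfolding adapted_expectation(2)[OF Z'] histories_Suc sum.reindex[OF inj]
    by (simp add: sum.cartesian_product split_def)
  also have "\<dots> \<le> (1 / ?N) ^ Suc t * (\<Sum>h\<in>histories t. ?N * at_history t Z h)"
    by (intro mult_left_mono sum_mono le) auto
  also have "\<dots> = expectation Z"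
    unfolding adapted_expectation(2)[OF Z] using node_sets_nonempty by (simp flip: sum_distrib_left)
  finally show ?thesis .
qed

end

lemma ereal_expectation_eq:
  fixes r :: "'w \<Rightarrow> real"
  assumes "integrable M r" "\<And>w. w \<in> space M \<Longrightarrow> Z w = ereal (r w)" "\<And>w. w \<in> space M \<Longrightarrow> 0 \<le> r w"
  shows "ereal_expectation M Z = ereal (integral\<^sup>L M r)"
proof -
  have "(\<integral>\<^sup>+ w. e2ennreal (Z w) \<partial>M) = (\<integral>\<^sup>+ w. ennreal (r w) \<partial>M)"
    using assms by (intro nn_integral_cong) (simp add: ennreal.abs_eq e2ennreal_def)
  also have "\<dots> = ennreal (integral\<^sup>L M r)"
    using assms by (intro nn_integral_eq_integral) auto
  finally have pos: "(\<integral>\<^sup>+ w. e2ennreal (Z w) \<partial>M) = ennreal (integral\<^sup>L M r)" .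
  have "(\<integral>\<^sup>+ w. e2ennreal (- Z w) \<partial>M) = (\<integral>\<^sup>+ w. 0 \<partial>M)"
    using assms by (intro nn_integral_cong) (auto simp: ennreal_neg)
  moreover have "0 \<le> integral\<^sup>L M r"
    using assms by (intro integral_nonneg_AE) auto
  ultimately show ?thesis
    by (simp add: ereal_expectation_def pos enn2ereal_ennreal zero_ennreal.rep_eq)
qed

section \<open>Runs of the algorithm\<close>

lemma block_running_average:
  "block (running_average x T) i = running_average (\<lambda>t. block (x t) i) T"
  by (simp add: running_average_def block_sum)

lemma closed_proper_convex_running_average:
  assumes f: "closed_proper_convex f" and fin: "\<And>t. t < T \<Longrightarrow> \<bar>f (u t)\<bar> \<noteq> \<infinity>" and T: "0 < T"
  shows "\<bar>f (running_average u T)\<bar> \<noteq> \<infinity>"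
    and "real_of_ereal (f (running_average u T)) \<le> (1 / real T) * (\<Sum>t<T. real_of_ereal (f (u t)))"
proof -
  have "convex (ext_epigraph f)" and ninf: "f (running_average u T) \<noteq> -\<infinity>"
    using f by (auto simp: closed_proper_convex_def)
  then have "(\<Sum>t<T. (1 / real T) *\<^sub>R (u t, real_of_ereal (f (u t)))) \<in> ext_epigraph f"
    using fin T by (intro convex_sum) (auto simp: ext_epigraph_def ereal_real)
  moreover have "(\<Sum>t<T. (1 / real T) *\<^sub>R (u t, real_of_ereal (f (u t))))
      = (running_average u T, (1 / real T) * (\<Sum>t<T. real_of_ereal (f (u t))))"
    by (rule prod_eqI)
      (simp_all add: running_average_def fst_sum snd_sum scaleR_sum_right sum_distrib_left)
  ultimately have "f (running_average u T) \<le> ereal ((1 / real T) * (\<Sum>t<T. real_of_ereal (f (u t))))"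
    by (simp add: ext_epigraph_def)
  with ninf show "\<bar>f (running_average u T)\<bar> \<noteq> \<infinity>"
    and "real_of_ereal (f (running_average u T)) \<le> (1 / real T) * (\<Sum>t<T. real_of_ereal (f (u t)))"
    by (cases "f (running_average u T)"; auto)+
qed

lemma running_average_in_convex:
  assumes "convex C" "\<And>t. t < T \<Longrightarrow> u t \<in> C" "0 < T"
  shows "running_average u T \<in> C"
  using convex_sum[of "{..<T}" C "\<lambda>_. 1 / real T" u] assms
  by (simp add: running_average_def scaleR_sum_right)

lemma norm_running_average_le:
  fixes u :: "nat \<Rightarrow> 'a::real_normed_vector"
  assumes T: "0 < T"
  shows "(norm (running_average u T))\<^sup>2 \<le> (1 / real T) * (\<Sum>t<T. (norm (u t))\<^sup>2)"
proof -
  have "(norm (\<Sum>t<T. u t))\<^sup>2 \<le> (\<Sum>t<T. norm (u t))\<^sup>2"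
    by (intro power_mono norm_sum) auto
  also have "\<dots> \<le> (\<Sum>t<T. (norm (u t))\<^sup>2) * real T"
    using sum_squared_le_sum_of_squares[of "\<lambda>t. norm (u t)" "{..<T}"] by simp
  finally have "(1 / real T)\<^sup>2 * (norm (\<Sum>t<T. u t))\<^sup>2 \<le> (1 / real T)\<^sup>2 * ((\<Sum>t<T. (norm (u t))\<^sup>2) * real T)"
    by (intro mult_left_mono) auto
  then show ?thesis
    using T by (simp add: running_average_def power_mult_distrib power2_eq_square divide_simps)
qed

context bpdmm
begin

abbreviation run ::
    "(nat \<Rightarrow> 'v set) \<Rightarrow> (nat \<Rightarrow> real^('v \<times> 'n)) \<Rightarrow> (nat \<Rightarrow> real^('v \<times> 'n)) \<Rightarrow>
     (nat \<Rightarrow> real^('v \<times> 'n)) \<Rightarrow> bool" where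
  "run S y x \<mu> \<equiv> stochastic_bpdmm E P f X D \<phi> \<tau> \<rho> S y x \<mu>"

lemma run_y: "run S y x \<mu> \<Longrightarrow> i \<in> S (Suc t) \<Longrightarrow> is_y_update (x t) i (block (y t) i)"
  by (simp add: stochastic_bpdmm_def is_y_update_def)

lemma run_x:
  "run S y x \<mu> \<Longrightarrow> i \<in> S (Suc t) \<Longrightarrow> is_x_update (\<mu> t) i (block (y t) i) (block (x (Suc t)) i)"
  by (simp add: stochastic_bpdmm_def is_x_update_def)

lemma run_idle: "run S y x \<mu> \<Longrightarrow> i \<notin> S (Suc t) \<Longrightarrow> block (x (Suc t)) i = block (x t) i"
  by (simp add: stochastic_bpdmm_def)

lemma run_dual:
  assumes "run S y x \<mu>"
  shows "\<mu> (Suc t) = \<mu> t + \<tau> *\<^sub>R Q (x (Suc t))"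
proof (rule block_eqI)
  fix i
  have "block (\<mu> (Suc t)) i = block (\<mu> t) i + \<tau> *\<^sub>R block (x (Suc t)) i
      - \<tau> *\<^sub>R (\<Sum>j\<in>neighbors E i. P $ i $ j *\<^sub>R block (x (Suc t)) j)"
    using assms by (simp add: stochastic_bpdmm_def)
  also have "(\<Sum>j\<in>neighbors E i. P $ i $ j *\<^sub>R block (x (Suc t)) j)
      = (\<Sum>j\<in>UNIV. P $ i $ j *\<^sub>R block (x (Suc t)) j)"
    by (rule neighbor_sum) simp
  finally show "block (\<mu> (Suc t)) i = block (\<mu> t + \<tau> *\<^sub>R Q (x (Suc t))) i"
    by (simp add: block_Q scaleR_diff_right)
qed

lemma run_previous_dual:
  assumes "run S y x \<mu>"
  shows "\<mu> t = previous_dual P \<tau> x \<mu> t + \<tau> *\<^sub>R Q (x t)"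
  using run_dual[OF assms] by (cases t) auto

lemma run_feasible:
  assumes run: "run S y x \<mu>" and x0: "feasible (x 0)"
  shows "feasible (x t)"
proof (induction t)
  case (Suc t)
  show ?case
    unfolding feasible_def
  proof
    fix i
    show "block (x (Suc t)) i \<in> X \<and> block (x (Suc t)) i \<in> D \<and> \<bar>f i (block (x (Suc t)) i)\<bar> \<noteq> \<infinity>"
    proof (cases "i \<in> S (Suc t)")
      case True
      note y = y_update_in[OF Suc run_y[OF run True]]
      have "block (x t) i \<in> X" "block (x t) i \<in> D" "\<bar>f i (block (x t) i)\<bar> \<noteq> \<infinity>"
        using Suc by (auto simp: feasible_def)
      from x_update_in[OF this y(2) run_x[OF run True]] show ?thesis by simp
    next
      case False
      then show ?thesis using Suc run_idle[OF run False] by (simp add: feasible_def)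
    qed
  qed
qed (rule x0)

lemma step_unique:
  assumes u: "feasible u"
    and "is_y_update u i y" "is_x_update m i y v" "is_y_update u i y'" "is_x_update m i y' v'"
  shows "v = v'"
proof -
  have "y' = y" using assms by (blast intro: y_update_unique)
  moreover have "y \<in> D" using assms by (blast intro: y_update_in)
  ultimately show ?thesis
    using assms x_update_unique[of "block u i" i y m v v'] by (auto simp: feasible_def)
qed

text \<open>Induction with \<open>step_unique\<close> at drawn nodes. The sequences y and y' are not
  compared, since their blocks at idle nodes are arbitrary.\<close>

lemma run_determined:
  assumes run: "run S y x \<mu>" "run S' y' x' \<mu>'" and x0: "feasible (x 0)"
    and init: "x 0 = x' 0" "\<mu> 0 = \<mu>' 0"
    and S: "\<And>k. 1 \<le> k \<Longrightarrow> k \<le> t \<Longrightarrow> S k = S' k"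
  shows "x t = x' t \<and> \<mu> t = \<mu>' t"
  using S
proof (induction t)
  case (Suc t)
  then have IH: "x t = x' t" "\<mu> t = \<mu>' t" and S: "S (Suc t) = S' (Suc t)" by auto
  have "x (Suc t) = x' (Suc t)"
  proof (rule block_eqI)
    fix i
    show "block (x (Suc t)) i = block (x' (Suc t)) i"
    proof (cases "i \<in> S (Suc t)")
      case True
      then have True': "i \<in> S' (Suc t)" using S by simp
      show ?thesis
        by (rule step_unique[OF run_feasible[OF run(1) x0, of t] run_y[OF run(1) True] run_x[OF run(1) True]
              run_y[OF run(2) True', folded IH] run_x[OF run(2) True', folded IH]])
    next
      case False
      then show ?thesis using run_idle[OF run(1) False] run_idle[OF run(2)] S IH by simp
    qed
  qed
  then show ?case using run_dual[OF run(1)] run_dual[OF run(2)] IH by simp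
qed (use init in simp)

text \<open>\<open>U A\<close> is the next iterate when A is drawn. The full update w takes its
  block i from some set \<open>B i\<close> containing i; by uniqueness every other set containing i
  gives the same block. After exchanging the sums, each node is updated in a fraction \<omega> of
  the sets, which produces the mixture bounded by \<open>descent\<close>.\<close>

lemma averaged_descent:
  fixes \<A> :: "'v set set"
  assumes u: "feasible u" and m: "m = m' + \<tau> *\<^sub>R Q u" and \<A>: "\<A> \<noteq> {}"
    and count: "\<And>i. real (card {A \<in> \<A>. i \<in> A}) = \<omega> * real (card \<A>)"
    and y: "\<And>A i. A \<in> \<A> \<Longrightarrow> i \<in> A \<Longrightarrow> is_y_update u i (Y A i)"
    and v: "\<And>A i. A \<in> \<A> \<Longrightarrow> i \<in> A \<Longrightarrow> is_x_update m i (Y A i) (block (U A) i)"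
    and idle: "\<And>A i. A \<in> \<A> \<Longrightarrow> i \<notin> A \<Longrightarrow> block (U A) i = block u i"
  shows "(\<Sum>A\<in>\<A>. lyap (U A) m) \<le> card \<A> * (lyap u m' - \<omega> * gap u - \<gamma> * \<rho> / 2 * (norm (Q u))\<^sup>2)"
proof -
  let ?N = "real (card \<A>)"
  have N: "0 < ?N" using \<A> by (simp add: card_gt_0_iff)
  have "\<exists>A. A \<in> \<A> \<and> i \<in> A" for i
  proof -
    have "{A \<in> \<A>. i \<in> A} \<noteq> {}" using count[of i] N \<omega> by force
    then show ?thesis by blast
  qed
  then obtain B where B: "\<And>i. B i \<in> \<A> \<and> i \<in> B i" by metis
  define w where "w i = block (U (B i)) i" for i
  have U_eq: "block (U A) i = w i" if "A \<in> \<A>" "i \<in> A" for A i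
    unfolding w_def using B[of i] that
    by (intro step_unique[OF u, of i "Y A i" m _ "Y (B i) i"] y v) auto
  let ?l = "local_term m"
  have "(\<Sum>A\<in>\<A>. \<Sum>i\<in>UNIV. ?l i (block (U A) i)) = (\<Sum>i\<in>UNIV. \<Sum>A\<in>\<A>. ?l i (block (U A) i))"
    by (rule sum.swap)
  also have "\<dots> = (\<Sum>i\<in>UNIV. ?N * (\<omega> * ?l i (w i) + (1 - \<omega>) * ?l i (block u i)))"
  proof (rule sum.cong[OF refl])
    fix i
    have "(\<Sum>A\<in>\<A>. ?l i (block (U A) i))
        = (\<Sum>A\<in>\<A>. ?l i (block u i) + (if i \<in> A then ?l i (w i) - ?l i (block u i) else 0))"
      using U_eq idle by (intro sum.cong) auto
    also have "\<dots> = ?N * ?l i (block u i) + real (card {A \<in> \<A>. i \<in> A}) * (?l i (w i) - ?l i (block u i))"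
      by (simp add: sum.distrib sum.If_cases Int_def)
    finally show "(\<Sum>A\<in>\<A>. ?l i (block (U A) i)) = ?N * (\<omega> * ?l i (w i) + (1 - \<omega>) * ?l i (block u i))"
      by (simp add: count algebra_simps)
  qed
  also have "\<dots> = ?N * (\<omega> * (\<Sum>i\<in>UNIV. ?l i (w i)) + (1 - \<omega>) * (\<Sum>i\<in>UNIV. ?l i (block u i)))"
    by (simp add: sum.distrib flip: sum_distrib_left)
  finally have "(\<Sum>A\<in>\<A>. lyap (U A) m)
      = ?N * (\<omega> * (\<Sum>i\<in>UNIV. ?l i (w i)) + (1 - \<omega>) * (\<Sum>i\<in>UNIV. ?l i (block u i))
        + \<omega> / (2 * \<tau>) * (norm (\<mu>s - m))\<^sup>2)"
    by (simp add: lyap_def sum.distrib distrib_left)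
  also have "\<dots> \<le> ?N * (lyap u m' - \<omega> * gap u - \<gamma> * \<rho> / 2 * (norm (Q u))\<^sup>2)"
    using B y v by (intro mult_left_mono descent[OF u _ _ m, where y="\<lambda>i. Y (B i) i"]) (auto simp: w_def)
  finally show ?thesis .
qed

section \<open>Running averages, and real values of the Lagrangian and of V\<close>

lemma gap_running_average:
  assumes x: "\<And>t. t < T \<Longrightarrow> feasible (x t)" and T: "0 < T"
  shows "block (running_average x T) i \<in> X"
    and "\<bar>f i (block (running_average x T) i)\<bar> \<noteq> \<infinity>"
    and "gap (running_average x T) \<le> (1 / real T) * (\<Sum>t<T. gap (x t))"
proof -
  have xX: "block (x t) i \<in> X" and xf: "\<bar>f i (block (x t) i)\<bar> \<noteq> \<infinity>" if "t < T" for t i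
    using x[OF that] by (auto simp: feasible_def)
  show "block (running_average x T) i \<in> X"
    unfolding block_running_average by (rule running_average_in_convex[OF convex_X xX T])
  show "\<bar>f i (block (running_average x T) i)\<bar> \<noteq> \<infinity>"
    unfolding block_running_average
    by (rule closed_proper_convex_running_average(1)[OF closed_proper_convex_f xf T])
  have lin: "\<mu>s \<bullet> Q (running_average x T) = (1 / real T) * (\<Sum>t<T. \<mu>s \<bullet> Q (x t))"
    by (simp add: running_average_def Q_self_adjoint[symmetric] inner_sum_right)
  have const: "c = (1 / real T) * (\<Sum>t<T. c)" for c :: real using T by simp
  have "(\<Sum>i\<in>UNIV. real_of_ereal (f i (block (running_average x T) i)) - real_of_ereal (f i (block xs i)))
      \<le> (\<Sum>i\<in>UNIV. (1 / real T) * (\<Sum>t<T. real_of_ereal (f i (block (x t) i)))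
          - (1 / real T) * (\<Sum>t<T. real_of_ereal (f i (block xs i))))"
    unfolding block_running_average const[symmetric]
    by (intro sum_mono diff_right_mono closed_proper_convex_running_average(2)[OF closed_proper_convex_f xf T])
  also have "\<dots> = (1 / real T) * (\<Sum>i\<in>UNIV. \<Sum>t<T. real_of_ereal (f i (block (x t) i)) - real_of_ereal (f i (block xs i)))"
    by (simp only: sum_subtractf right_diff_distrib sum_distrib_left)
  also have "\<dots> = (1 / real T) * (\<Sum>t<T. \<Sum>i\<in>UNIV. real_of_ereal (f i (block (x t) i)) - real_of_ereal (f i (block xs i)))"
    by (subst sum.swap) simp
  finally show "gap (running_average x T) \<le> (1 / real T) * (\<Sum>t<T. gap (x t))"
    unfolding gap_def lin by (simp only: sum.distrib distrib_left add_right_mono)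
qed

lemma disagreement_running_average:
  assumes "0 < T"
  shows "(norm (Q (running_average x T)))\<^sup>2 \<le> (1 / real T) * (\<Sum>t<T. (norm (Q (x t)))\<^sup>2)"
proof -
  have Qsum: "Q (\<Sum>t<T. x t) = (\<Sum>t<T. Q (x t))"
    by (simp add: disagreement_eq sum_subtractf linear_sum[OF mix.lin])
  have "Q (running_average x T) = running_average (\<lambda>t. Q (x t)) T"
    by (simp only: running_average_def Q_simps Qsum)
  then show ?thesis using norm_running_average_le[OF assms, of "\<lambda>t. Q (x t)"] by simp
qed

lemma lagrangian_eq:
  assumes "\<And>i. block u i \<in> X" "\<And>i. \<bar>f i (block u i)\<bar> \<noteq> \<infinity>"
  shows "lagrangian f X P u m = ereal ((\<Sum>i\<in>UNIV. real_of_ereal (f i (block u i))) + m \<bullet> Q u)"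
proof -
  have "(\<Sum>i\<in>UNIV. f i (block u i) + set_indicator X (block u i))
      = (\<Sum>i\<in>UNIV. ereal (real_of_ereal (f i (block u i))))"
    using assms by (intro sum.cong) (auto simp: set_indicator_def ereal_real)
  then show ?thesis by (simp add: lagrangian_def)
qed

lemma lagrangian_gap:
  assumes "\<And>i. block u i \<in> X" "\<And>i. \<bar>f i (block u i)\<bar> \<noteq> \<infinity>"
  shows "lagrangian f X P u \<mu>s - lagrangian f X P xs \<mu>s = ereal (gap u)"
  using assms saddle_in_X f_saddle_finite by (simp add: lagrangian_eq Q_saddle gap_def sum_subtractf)

text \<open>The correction -\<tau> times the squared disagreement in H is exactly what lowers the
  dual index by one in the coupling term; the convention for the dual variable at time -1 lets this
  hold at t = 0 as well.\<close>

lemma lyapunov_V_eq: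
  assumes "run S y x \<mu>" "feasible (x t)"
  shows "lyapunov_V f X D \<phi> P \<tau> \<rho> \<omega> xs \<mu>s x \<mu> t = ereal (lyap (x t) (previous_dual P \<tau> x \<mu> t))"
proof -
  let ?m = "previous_dual P \<tau> x \<mu> t"
  have "\<mu> t \<bullet> Q (x t) - \<tau> * (norm (Q (x t)))\<^sup>2 = ?m \<bullet> Q (x t)"
    by (subst run_previous_dual[OF assms(1)]) (simp add: inner_add_left power2_norm_eq_inner)
  then have "(\<Sum>i\<in>UNIV. real_of_ereal (f i (block (x t) i))) + \<mu> t \<bullet> Q (x t)
      - (\<Sum>i\<in>UNIV. real_of_ereal (f i (block xs i))) - \<tau> * (norm (Q (x t)))\<^sup>2
      = gap (x t) + (?m - \<mu>s) \<bullet> Q (x t)"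
    by (simp add: gap_def sum_subtractf inner_diff_left)
  then show ?thesis
    using assms(2) saddle_in_X f_saddle_finite finite_saddle
    by (simp add: lyapunov_V_def lyapunov_H_def lagrangian_eq feasible_def Q_saddle lyap_def
        sum_local_term bregman_eq_breg)
qed

end

section \<open>The stochastic process\<close>

text \<open>The iterates are plain functions of the sample point; \<open>adapted_state\<close> makes
  functions of them random variables. \<open>feasible_x0\<close> contains the other part of V(0) <
  \<infinity>, finiteness of f at the initial blocks.\<close>

locale bpdmm_process =
  bpdmm X D \<phi> E P f \<beta> \<tau> \<rho> \<gamma> \<omega> xs \<mu>s + node_sampling M \<omega> S
  for X D :: "(real^'n::finite) set" and \<phi> :: "real^'n \<Rightarrow> real"
    and E :: "('v::finite \<times> 'v) set" and P :: "real^'v^'v" and f :: "'v \<Rightarrow> real^'n \<Rightarrow> ereal"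
    and \<beta> \<tau> \<rho> \<gamma> \<omega> :: real and xs \<mu>s :: "real^('v \<times> 'n)"
    and M :: "'w measure" and S :: "nat \<Rightarrow> 'w \<Rightarrow> 'v set" +
  fixes x y \<mu> :: "nat \<Rightarrow> 'w \<Rightarrow> real^('v \<times> 'n)" and x0 \<mu>0 :: "real^('v \<times> 'n)"
  assumes init: "w \<in> space M \<Longrightarrow> x 0 w = x0" "w \<in> space M \<Longrightarrow> \<mu> 0 w = \<mu>0"
    and alg: "w \<in> space M \<Longrightarrow> run (\<lambda>t. S t w) (\<lambda>t. y t w) (\<lambda>t. x t w) (\<lambda>t. \<mu> t w)"
    and feasible_x0: "feasible x0"
begin

lemma feasible_x: "w \<in> space M \<Longrightarrow> feasible (x t w)"
  using run_feasible[OF alg] by (simp add: init feasible_x0)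

lemma history_eq_S:
  assumes "history t w = history t w'" "1 \<le> k" "k \<le> t"
  shows "S k w = S k w'"
  using assms by (auto simp: history_def simp del: upt_Suc)

lemma state_determined:
  assumes "w \<in> space M" "w' \<in> space M" "history T w = history T w'" "t \<le> T"
  shows "x t w = x t w' \<and> \<mu> t w = \<mu> t w'"
  using assms history_eq_S[OF assms(3)]
  by (intro run_determined[OF alg alg]) (auto simp: init feasible_x0)

lemma adapted_state: "adapted t (\<lambda>w. g (x t w) (\<mu> t w))"
  unfolding adapted_def using state_determined by (metis order_refl)

abbreviation lyap_at :: "nat \<Rightarrow> 'w \<Rightarrow> real" where
  "lyap_at t w \<equiv> lyap (x t w) (previous_dual P \<tau> (\<lambda>t. x t w) (\<lambda>t. \<mu> t w) t)"

abbreviation decrease :: "nat \<Rightarrow> 'w \<Rightarrow> real" where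
  "decrease t w \<equiv> \<omega> * gap (x t w) + \<gamma> * \<rho> / 2 * (norm (Q (x t w)))\<^sup>2"

lemma previous_dual_eq:
  assumes "w \<in> space M"
  shows "previous_dual P \<tau> (\<lambda>t. x t w) (\<lambda>t. \<mu> t w) t = \<mu> t w - \<tau> *\<^sub>R Q (x t w)"
  unfolding eq_diff_eq by (rule run_previous_dual[OF alg[OF assms], symmetric])

text \<open>The factor c allows the uses c = 0 and c = 1. The previous dual variable is recovered
  from the current state by \<open>previous_dual_eq\<close>, so determinacy of the state at time t
  suffices.\<close>

lemma adapted_lyap: "adapted t (\<lambda>w. lyap_at t w - c * decrease t w)"
  unfolding adapted_def
proof (intro ballI impI)
  fix w w' assume w: "w \<in> space M" "w' \<in> space M" and h: "history t w = history t w'"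
  have "x t w = x t w'" "\<mu> t w = \<mu> t w'"
    using state_determined[OF w h order_refl] by auto
  then show "lyap_at t w - c * decrease t w = lyap_at t w' - c * decrease t w'"
    by (simp only: previous_dual_eq[OF w(1)] previous_dual_eq[OF w(2)])
qed

lemma adapted_lyap_at: "adapted t (lyap_at t)"
  using adapted_lyap[of t 0] by simp

text \<open>Each \<open>W A\<close> shares the state of w at time t and then draws A, so the runs at
  these sample points are the possible next steps from that state.\<close>

lemma expected_descent:
  "expectation (lyap_at (Suc t)) \<le> expectation (\<lambda>w. lyap_at t w - decrease t w)"
proof (rule expectation_step_le)
  show "adapted t (\<lambda>w. lyap_at t w - decrease t w)" using adapted_lyap[of t 1] by simp
  show "adapted (Suc t) (lyap_at (Suc t))" by (rule adapted_lyap_at)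
next
  fix w W assume w: "w \<in> space M" and W: "\<And>A. A \<in> \<A> \<Longrightarrow> W A \<in> space M"
    and "\<And>A. A \<in> \<A> \<Longrightarrow> history (Suc t) (W A) = history t w @ [A]"
  then have hist: "history t (W A) = history t w" and S: "S (Suc t) (W A) = A" if "A \<in> \<A>" for A
    using that by (auto simp: history_Suc)
  have state: "x t (W A) = x t w" "\<mu> t (W A) = \<mu> t w" if "A \<in> \<A>" for A
    using state_determined[OF W[OF that] w hist[OF that], of t] by auto
  have "(\<Sum>A\<in>\<A>. lyap_at (Suc t) (W A)) = (\<Sum>A\<in>\<A>. lyap (x (Suc t) (W A)) (\<mu> t w))"
    using state by (intro sum.cong) auto
  also have "\<dots> \<le> card \<A> * (lyap (x t w) (previous_dual P \<tau> (\<lambda>t. x t w) (\<lambda>t. \<mu> t w) t)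
      - \<omega> * gap (x t w) - \<gamma> * \<rho> / 2 * (norm (Q (x t w)))\<^sup>2)"
  proof (rule averaged_descent[where Y="\<lambda>A i. block (y t (W A)) i"])
    fix A i assume A: "A \<in> \<A>"
    note run = alg[OF W[OF A]]
    show "is_y_update (x t w) i (block (y t (W A)) i)" if "i \<in> A"
      using run_y[OF run, of i t] that S[OF A] state[OF A] by simp
    show "is_x_update (\<mu> t w) i (block (y t (W A)) i) (block (x (Suc t) (W A)) i)" if "i \<in> A"
      using run_x[OF run, of i t] that S[OF A] state[OF A] by simp
    show "block (x (Suc t) (W A)) i = block (x t w) i" if "i \<notin> A"
      using run_idle[OF run, of i t] that S[OF A] state[OF A] by simp
  next
    show "\<mu> t w = previous_dual P \<tau> (\<lambda>t. x t w) (\<lambda>t. \<mu> t w) t + \<tau> *\<^sub>R Q (x t w)"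
      by (rule run_previous_dual[OF alg[OF w]])
    show "real (card {A \<in> \<A>. i \<in> A}) = \<omega> * real (card \<A>)" for i
      by (rule card_node_sets_containing[OF \<omega>(1) node_sets_nonempty])
  qed (use feasible_x w node_sets_nonempty in auto)
  finally show "(\<Sum>A\<in>\<A>. lyap_at (Suc t) (W A)) \<le> card \<A> * (lyap_at t w - decrease t w)"
    by (simp add: algebra_simps)
qed

lemma integrable_state:
  fixes g :: "real^('v \<times> 'n) \<Rightarrow> real"
  shows "integrable M (\<lambda>w. g (x t w))"
  by (rule adapted_expectation(1)[OF adapted_state[of t "\<lambda>u _. g u"]])

lemma integrable_running_average:
  fixes g :: "real^('v \<times> 'n) \<Rightarrow> real"
  shows "integrable M (\<lambda>w. g (running_average (\<lambda>t. x t w) T))"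
proof (rule adapted_expectation(1)[where t=T])
  show "adapted T (\<lambda>w. g (running_average (\<lambda>t. x t w) T))"
    unfolding adapted_def
  proof (intro ballI impI)
    fix w w' assume w: "w \<in> space M" "w' \<in> space M" "history T w = history T w'"
    have "(\<Sum>t<T. x t w) = (\<Sum>t<T. x t w')"
      using state_determined[OF w] by (intro sum.cong) auto
    then show "g (running_average (\<lambda>t. x t w) T) = g (running_average (\<lambda>t. x t w') T)"
      by (simp add: running_average_def)
  qed
qed

lemma gap_x_nonneg: "w \<in> space M \<Longrightarrow> 0 \<le> gap (x t w)"
  using feasible_x[of w t] by (intro gap_nonneg) (auto simp: feasible_def)

text \<open>The final Lyapunov value is dropped as nonnegative, and the initial one is constant on
  \<open>space M\<close>, so it can be read off at \<open>w0\<close>.\<close>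

lemma telescoped:
  assumes "w0 \<in> space M"
  shows "(\<Sum>t<T. expectation (decrease t)) \<le> lyap_at 0 w0"
proof -
  have "expectation (lyap_at T) + (\<Sum>t<T. expectation (decrease t)) \<le> expectation (lyap_at 0)"
  proof (induction T)
    case (Suc T)
    have "expectation (\<lambda>w. lyap_at T w - decrease T w) = expectation (lyap_at T) - expectation (decrease T)"
      by (intro Bochner_Integration.integral_diff adapted_expectation(1)[OF adapted_lyap_at] integrable_state)
    then show ?case using Suc expected_descent[of T] by simp
  qed simp
  moreover have "0 \<le> expectation (lyap_at T)"
    using feasible_x by (intro integral_nonneg_AE AE_I2 lyap_nonneg)
  moreover have "expectation (lyap_at 0) = expectation (\<lambda>_. lyap_at 0 w0)"
    using assms by (intro Bochner_Integration.integral_cong) (simp_all add: init)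
  ultimately show ?thesis by (simp add: prob_space)
qed

lemma expected_gap_bound:
  assumes w0: "w0 \<in> space M" and T: "0 < T"
  shows "expectation (\<lambda>w. gap (running_average (\<lambda>t. x t w) T)) \<le> lyap_at 0 w0 / (\<omega> * T)"
proof -
  have "\<omega> * expectation (\<lambda>w. gap (x t w)) \<le> expectation (decrease t)" for t
  proof -
    have "expectation (\<lambda>w. \<omega> * gap (x t w)) \<le> expectation (decrease t)"
      using \<gamma> \<rho> by (intro integral_mono integrable_state) auto
    then show ?thesis by simp
  qed
  then have "(\<Sum>t<T. \<omega> * expectation (\<lambda>w. gap (x t w))) \<le> (\<Sum>t<T. expectation (decrease t))"
    by (intro sum_mono)
  also have "\<dots> \<le> lyap_at 0 w0" by (rule telescoped[OF w0])
  finally have sum: "\<omega> * (\<Sum>t<T. expectation (\<lambda>w. gap (x t w))) \<le> lyap_at 0 w0"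
    by (simp add: sum_distrib_left)
  have "expectation (\<lambda>w. gap (running_average (\<lambda>t. x t w) T))
      \<le> expectation (\<lambda>w. (1 / real T) * (\<Sum>t<T. gap (x t w)))"
    by (intro integral_mono integrable_running_average integrable_mult_right
        Bochner_Integration.integrable_sum integrable_state gap_running_average(3) feasible_x T)
  also have "\<dots> = (1 / real T) * (\<Sum>t<T. expectation (\<lambda>w. gap (x t w)))"
    by (subst integral_mult_right_zero, subst Bochner_Integration.integral_sum) (rule integrable_state refl)+
  also have "\<dots> \<le> lyap_at 0 w0 / (\<omega> * T)"
    using sum \<omega> T by (simp add: field_simps)
  finally show ?thesis .
qed

text \<open>Here the gap is the part of \<open>decrease\<close> that is discarded; the weight
  \<gamma> \<rho> / 2 accounts for the factor 1/2 on the left.\<close>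

lemma expected_disagreement_bound:
  assumes w0: "w0 \<in> space M" and T: "0 < T"
  shows "expectation (\<lambda>w. 1 / 2 * (norm (Q (running_average (\<lambda>t. x t w) T)))\<^sup>2)
    \<le> lyap_at 0 w0 / (\<gamma> * \<rho> * T)"
proof -
  have "\<gamma> * \<rho> / 2 * expectation (\<lambda>w. (norm (Q (x t w)))\<^sup>2) \<le> expectation (decrease t)" for t
  proof -
    have "expectation (\<lambda>w. \<gamma> * \<rho> / 2 * (norm (Q (x t w)))\<^sup>2) \<le> expectation (decrease t)"
      using \<omega> gap_x_nonneg by (intro integral_mono integrable_state) auto
    then show ?thesis by simp
  qed
  then have "(\<Sum>t<T. \<gamma> * \<rho> / 2 * expectation (\<lambda>w. (norm (Q (x t w)))\<^sup>2)) \<le> (\<Sum>t<T. expectation (decrease t))"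
    by (intro sum_mono)
  also have "\<dots> \<le> lyap_at 0 w0" by (rule telescoped[OF w0])
  finally have sum: "\<gamma> * \<rho> / 2 * (\<Sum>t<T. expectation (\<lambda>w. (norm (Q (x t w)))\<^sup>2)) \<le> lyap_at 0 w0"
    by (simp add: sum_distrib_left)
  have "expectation (\<lambda>w. 1 / 2 * (norm (Q (running_average (\<lambda>t. x t w) T)))\<^sup>2)
      \<le> expectation (\<lambda>w. 1 / 2 * ((1 / real T) * (\<Sum>t<T. (norm (Q (x t w)))\<^sup>2)))"
    by (intro integral_mono integrable_running_average integrable_mult_right mult_left_mono
        Bochner_Integration.integrable_sum integrable_state disagreement_running_average T) auto
  also have "\<dots> = 1 / 2 * ((1 / real T) * (\<Sum>t<T. expectation (\<lambda>w. (norm (Q (x t w)))\<^sup>2)))"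
    by (subst integral_mult_right_zero, subst integral_mult_right_zero,
        subst Bochner_Integration.integral_sum) (rule integrable_state refl)+
  also have "\<dots> \<le> lyap_at 0 w0 / (\<gamma> * \<rho> * T)"
    using sum \<gamma> \<rho> T by (simp add: field_simps)
  finally show ?thesis .
qed

end

text \<open>In \<open>ereal\<close>, \<infinity> absorbs every summand, including -\<infinity>, so a
  single infinite term decides the value.\<close>

lemma lyapunov_V_eq_PInfty:
  assumes "(\<exists>i. f i (block (x t) i) = \<infinity>) \<or> (\<exists>i. closure_extension D \<phi> (block xs i) = \<infinity>)" and "0 < \<rho>"
  shows "lyapunov_V f X D \<phi> P \<tau> \<rho> \<omega> xs \<mu>s x \<mu> t = \<infinity>"
  using assms(1)
proof
  assume "\<exists>i. f i (block (x t) i) = \<infinity>"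
  then have "(\<Sum>i\<in>UNIV. f i (block (x t) i) + set_indicator X (block (x t) i)) = \<infinity>"
    by (auto simp: sum_Pinfty set_indicator_def)
  then show ?thesis
    by (simp add: lyapunov_V_def lyapunov_H_def lagrangian_def minus_ereal_def)
next
  assume "\<exists>i. closure_extension D \<phi> (block xs i) = \<infinity>"
  then obtain i where "closure_extension D \<phi> (block xs i) = \<infinity>" ..
  then have "bregman D \<phi> (block xs i) (block (x t) i) = \<infinity>" by (simp add: bregman_def)
  then have "(\<Sum>i\<in>UNIV. bregman D \<phi> (block xs i) (block (x t) i)) = \<infinity>"
    by (auto simp: sum_Pinfty)
  then show ?thesis using \<open>0 < \<rho>\<close> by (simp add: lyapunov_V_def)
qed

text \<open>The start is deterministic, so V(0) is the same at every sample point, and the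
  quantifier over \<open>w\<^sub>0\<close> merely names a point at which to evaluate it.\<close>

theorem corollary1:
  fixes E :: "('v::finite \<times> 'v) set"
    and P :: "real^'v^'v"
    and f :: "'v \<Rightarrow> real^'n::finite \<Rightarrow> ereal"
    and X D :: "(real^'n) set"
    and \<phi> :: "real^'n \<Rightarrow> real"
    and p :: ereal
    and \<alpha> \<sigma> \<tau> \<rho> \<gamma> \<omega> :: real
    and xs \<mu>s x0 \<mu>0 :: "real^('v \<times> 'n)"
    and M :: "'w measure"
    and S :: "nat \<Rightarrow> 'w \<Rightarrow> 'v set"
    and x y \<mu> :: "nat \<Rightarrow> 'w \<Rightarrow> real^('v \<times> 'n)"
    and T :: nat
  assumes graph: "connected_graph E"
    and P_graph: "defined_on_graph P E"
    and f: "\<And>i. closed_proper_convex (f i)"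
    and X: "closed X" "convex X"
    and saddle: "saddle_point f X P xs \<mu>s"
    and D: "open D" "convex D" "X \<subseteq> closure D"
    and mirror: "mirror_map D \<phi>"
    and p: "1 \<le> p"
    and strong: "0 < \<alpha>" "bregman_strongly_convex X D \<phi> \<alpha> p"
    and P: "transpose P = P" "stochastic P" "irreducible_matrix P" "pos_semidef P"
    and \<omega>: "0 < \<omega>" "\<omega> < 1"
    and M: "prob_space M"
    and S: "random_node_sets M \<omega> S"
    and parameters: "0 < \<tau>" "0 < \<rho>"
    and init: "\<And>w. w \<in> space M \<Longrightarrow> x 0 w = x0" "\<And>w. w \<in> space M \<Longrightarrow> \<mu> 0 w = \<mu>0"
    and alg: "\<And>w. w \<in> space M \<Longrightarrow>
       stochastic_bpdmm E P f X D \<phi> \<tau> \<rho> (\<lambda>t. S t w) (\<lambda>t. y t w) (\<lambda>t. x t w) (\<lambda>t. \<mu> t w)"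
    and \<sigma>: "\<sigma> = min 1 (real CARD('n) powr real_of_ereal (2 / p - 1))"
    and step: "\<tau> \<le> \<rho> * (\<omega> * \<alpha> * \<sigma> - \<gamma>) / (2 - \<omega>)"
    and \<gamma>: "0 < \<gamma>" "\<gamma> < \<omega> * \<alpha> * \<sigma>"
    and T: "0 < T"
  shows "\<forall>w\<^sub>0\<in>space M.
      (let V0 = lyapunov_V f X D \<phi> P \<tau> \<rho> \<omega> xs \<mu>s (\<lambda>t. x t w\<^sub>0) (\<lambda>t. \<mu> t w\<^sub>0) 0 in
       ereal_expectation M
         (\<lambda>w. lagrangian f X P (running_average (\<lambda>t. x t w) T) \<mu>s - lagrangian f X P xs \<mu>s)
         \<le> V0 / ereal (\<omega> * real T) \<and>
       ereal_expectation M
         (\<lambda>w. ereal (1/2 * (norm (disagreement P (running_average (\<lambda>t. x t w) T)))\<^sup>2))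
         \<le> V0 / ereal (\<gamma> * \<rho> * real T))"
proof
  fix w0 assume w0: "w0 \<in> space M"
  let ?V0 = "lyapunov_V f X D \<phi> P \<tau> \<rho> \<omega> xs \<mu>s (\<lambda>t. x t w0) (\<lambda>t. \<mu> t w0) 0"
  interpret mirror_space X D \<phi>
    using X D mirror by unfold_locales
  have x0: "block x0 i \<in> X" "block x0 i \<in> D" for i
    using alg[OF w0] init(1)[OF w0] by (auto simp: stochastic_bpdmm_def)
  have not_MInf: "f i u \<noteq> -\<infinity>" "\<Phi> u \<noteq> -\<infinity>" for i u
    using f[of i] closure_extension_not_MInf[OF x0(2)] by (auto simp: closed_proper_convex_def)
  show "let V0 = ?V0 in
       ereal_expectation M
         (\<lambda>w. lagrangian f X P (running_average (\<lambda>t. x t w) T) \<mu>s - lagrangian f X P xs \<mu>s)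
         \<le> V0 / ereal (\<omega> * real T) \<and>
       ereal_expectation M
         (\<lambda>w. ereal (1/2 * (norm (disagreement P (running_average (\<lambda>t. x t w) T)))\<^sup>2))
         \<le> V0 / ereal (\<gamma> * \<rho> * real T)"
  proof (cases "\<forall>i. \<bar>f i (block x0 i)\<bar> \<noteq> \<infinity> \<and> \<bar>\<Phi> (block xs i)\<bar> \<noteq> \<infinity>")
    case False
    then have "?V0 = \<infinity>"
      using not_MInf parameters init(1)[OF w0] by (intro lyapunov_V_eq_PInfty) auto
    then show ?thesis
      using \<omega> \<gamma> parameters T by (simp add: Let_def)
  next
    case True
    have "0 < \<omega> * (\<alpha> * \<sigma>)" using \<gamma> by (simp add: mult.assoc)
    then have \<beta>: "0 < \<alpha> * \<sigma>" using \<omega> by (simp add: zero_less_mult_iff)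
    have strong': "ereal (\<alpha> * \<sigma> / 2 * (norm (u - v))\<^sup>2) \<le> bregman D \<phi> u v"
      if "u \<in> X" "v \<in> X" "v \<in> D" for u v
    proof -
      have "\<alpha> / 2 * (\<sigma> * (norm (u - v))\<^sup>2) \<le> \<alpha> / 2 * (lp_norm p (u - v))\<^sup>2"
        unfolding \<sigma> using strong(1) by (intro mult_left_mono lp_norm_ge[OF p]) auto
      then have "ereal (\<alpha> * \<sigma> / 2 * (norm (u - v))\<^sup>2) \<le> ereal (\<alpha> / 2 * (lp_norm p (u - v))\<^sup>2)"
        by simp
      also have "\<dots> \<le> bregman D \<phi> u v"
        using strong(2) that by (auto simp: bregman_strongly_convex_def)
      finally show ?thesis .
    qed
    have step': "\<tau> * (2 - \<omega>) \<le> \<rho> * (\<omega> * (\<alpha> * \<sigma>) - \<gamma>)"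
      using step \<omega> by (simp add: pos_le_divide_eq mult.assoc)
    interpret bpdmm X D \<phi> E P f "\<alpha> * \<sigma>" \<tau> \<rho> \<gamma> \<omega> xs \<mu>s
      by unfold_locales
        (use P_graph f saddle \<beta> strong' P \<omega> parameters \<gamma> step' True in auto)
    interpret prob_space M by (rule M)
    interpret bpdmm_process X D \<phi> E P f "\<alpha> * \<sigma>" \<tau> \<rho> \<gamma> \<omega> xs \<mu>s M S x y \<mu> x0 \<mu>0
      by unfold_locales (use S init alg x0 True in \<open>auto simp: feasible_def\<close>)
    have V0: "?V0 = ereal (lyap_at 0 w0)"
      by (rule lyapunov_V_eq[OF alg[OF w0] feasible_x[OF w0]])
    have avg: "block (running_average (\<lambda>t. x t w) T) i \<in> X"
        "\<bar>f i (block (running_average (\<lambda>t. x t w) T) i)\<bar> \<noteq> \<infinity>" if "w \<in> space M" for w i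
      using gap_running_average[OF feasible_x[OF that] T] by auto
    have "ereal_expectation M
         (\<lambda>w. lagrangian f X P (running_average (\<lambda>t. x t w) T) \<mu>s - lagrangian f X P xs \<mu>s)
        = ereal (expectation (\<lambda>w. gap (running_average (\<lambda>t. x t w) T)))"
      using avg by (intro ereal_expectation_eq integrable_running_average lagrangian_gap gap_nonneg)
    moreover have "ereal_expectation M
         (\<lambda>w. ereal (1/2 * (norm (disagreement P (running_average (\<lambda>t. x t w) T)))\<^sup>2))
        = ereal (expectation (\<lambda>w. 1/2 * (norm (disagreement P (running_average (\<lambda>t. x t w) T)))\<^sup>2))"
      by (intro ereal_expectation_eq integrable_running_average) auto
    ultimately show ?thesis
      using expected_gap_bound[OF w0 T] expected_disagreement_bound[OF w0 T] \<omega> \<gamma> parameters T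
      by (simp add: V0 Let_def)
  qed
qed

end
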